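(* Let $(\mathcal A,\tau)$ be a unital noncommutative probability space with $\tau$ a faithful tracial state. Let $(\sigma_n)_{n\ge1}$ be positive numbers. Let $(g_n)_{n\ge1}$ be finite simple graphs with $V(g_n)=[n]$, and consider the node-weighted graphs $(g_n,\sigma^2)$, where vertex $i\in[n]$ has weight $\sigma^2(i)=\sigma_i^2$. Write $|\sigma^2|=\sum_{i\in[n]}\sigma_i^2$ and $\sigma_{\max}^2=\max_{i\in[n]}\sigma_i^2$ (both depending on $n$). Assume that $(g_n,\sigma^2)_n$ converges to a graphon $w:[0,1]^2\to[0,1]$ and that, as $n\to\infty$, $$|\sigma^2|\to\infty,\qquad \frac{\sigma_{\max}^2}{|\sigma^2|}\to0.$$ For every $n\ge1$, let $a_1^{(n)},\ldots,a_n^{(n)}\in\mathcal A$ be $g_n$-independent centered self-adjoint random variables with variance $\operatorname{var}(a_k^{(n)})=\sigma_k^2$. Assume that there exist constants $C_p\ge1$, depending only on $p\ge1$, such that for all $n\ge1$, $k\in[n]$ and $p\ge1$, $$\tau\left(|a_k^{(n)}|^p\right)\le C_p\,\sigma_k^p.$$ Then $$S_n=\frac{1}{\sqrt{|\sigma^2|}}\sum_{k\in[n]}a_k^{(n)}$$ converges in distribution, as $n\to\infty$, to $\mu_w$.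
   Context: Noncommutative probability: $\mathcal A$ is a unital $*$-algebra over $\mathbb C$ and $\tau:\mathcal A\to\mathbb C$ is linear with $\tau(1)=1$, $\tau(a^*a)\ge0$, faithful and tracial. An element $a$ is centered if $\tau(a)=0$; the variance of a self-adjoint centered $a$ is $\operatorname{var}(a)=\tau(a^2)$. For self-adjoint $a$, $\tau(|a|^p)$ is the $p$-th absolute moment of the distribution of $a$ (so it equals $\tau(a^p)$ for $p$ even). Self-adjoint elements $a_n$ converge in distribution to a law $\mu$ if $\tau(a_n^p)\to\int x^p\,\mathrm d\mu$ for every $p\in\mathbb N$. $g$-independence: let $g=([n],E)$ be a loopless (undirected) graph. Unital subalgebras $\mathcal A_1,\ldots,\mathcal A_n\subset\mathcal A$ are $g$-independent if (1) for every $(i,j)\in E$, $\mathcal A_i$ and $\mathcal A_j$ are classically independent, i.e. they commute and $\tau(ab)=0$ for all centered $a\in\mathcal A_i$, $b\in\mathcal A_j$; (2) for every $k\ge1$ and every $i\in[n]^k$ such that for all $j_1<j_2$ with $i_{j_1}=i_{j_2}$ there exists $j_1<j_3<j_2$ with $(i_{j_1},i_{j_3})\notin E$, one has $\tau(a_1\cdots a_k)=0$ for all centered $a_j\in\mathcal A_{i_j}$, $j\in[k]$. Self-adjoint elements are $g$-independent if the unital subalgebras they generate are. Graphons: a graphon is a measurable symmetric function $w:[0,1]^2\to[0,1]$; for a finite simple graph $f$, $\rho(f,w)=\int_{[0,1]^{V(f)}}\prod_{(u,v)\in E(f)}w(x_u,x_v)\,\mathrm dx$ (each edge counted once). For a node-weighted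 graph $(g,\alpha)$, $\alpha:V(g)\to[0,\infty)$, $|\alpha|=\sum_{i\in V(g)}\alpha(i)$, put $$\rho(f,(g,\alpha))=\frac{1}{|\alpha|^{|V(f)|}}\sum_{\phi\in\mathrm{Hom}(f,g)}\prod_{v\in V(f)}\alpha(\phi(v)),$$ where $\mathrm{Hom}(f,g)$ is the set of graph homomorphisms from $f$ to $g$. The sequence $(g_n,\alpha_n)$ converges to $w$ if $\rho(f,(g_n,\alpha_n))\to\rho(f,w)$ for every finite simple graph $f$. Limit law: $P_2(p)$ is the set of pair partitions of $[p]$. Two blocks cross if there are $i<k<j<l$ with $\{i,j\}$ contained in one of them and $\{k,l\}$ in the other. The intersection graph $f_\pi$ has the blocks of $\pi$ as vertices, with an edge between two distinct blocks iff they cross. $\mu_w$ is the probability measure on $\mathbb R$ whose odd moments vanish and with $\int x^{2p}\,\mathrm d\mu_w=\sum_{\pi\in P_2(2p)}\rho(f_\pi,w)$ for all $p\ge1$. *)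

theory Defs
  imports "HOL-Probability.Probability"
begin

locale nc_prob_space = vector_space smul
  for smul :: "complex \<Rightarrow> 'a::ring_1 \<Rightarrow> 'a" +
  fixes star :: "'a \<Rightarrow> 'a" and \<tau> :: "'a \<Rightarrow> complex"
  assumes scale_mult_left: "smul c a * b = smul c (a * b)"
    and scale_mult_right: "a * smul c b = smul c (a * b)"
    and star_star: "star (star a) = a"
    and star_add: "star (a + b) = star a + star b"
    and star_scale: "star (smul c a) = smul (cnj c) (star a)"
    and star_mult: "star (a * b) = star b * star a"
    and state_linear: "Vector_Spaces.linear smul (*) \<tau>"
    and state_one: "\<tau> 1 = 1"
    and state_pos: "\<tau> (star a * a) \<in> \<real>\<^sub>\<ge>\<^sub>0"
    and state_faithful: "\<tau> (star a * a) = 0 \<Longrightarrow> a = 0"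
    and state_tracial: "\<tau> (a * b) = \<tau> (b * a)"

definition unital_subalgebra :: "(complex \<Rightarrow> 'a::ring_1 \<Rightarrow> 'a) \<Rightarrow> 'a set \<Rightarrow> bool" where
  "unital_subalgebra smul B \<longleftrightarrow>
     1 \<in> B \<and> (\<forall>a\<in>B. \<forall>b\<in>B. a + b \<in> B \<and> a * b \<in> B) \<and> (\<forall>c. \<forall>a\<in>B. smul c a \<in> B)"

text \<open>A distribution of a self-adjoint element is a law on the line with the same moments.
  In a general unital star-algebra one always exists, but it need not be unique.\<close>

definition is_distribution_of :: "('a::ring_1 \<Rightarrow> complex) \<Rightarrow> 'a \<Rightarrow> real measure \<Rightarrow> bool" where
  "is_distribution_of \<tau> a \<nu> \<longleftrightarrow> real_distribution \<nu> \<and>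
     (\<forall>p::nat. integrable \<nu> (\<lambda>x. x ^ p) \<and> \<tau> (a ^ p) = complex_of_real (\<integral>x. x ^ p \<partial>\<nu>))"

definition converges_in_distribution ::
    "('a::ring_1 \<Rightarrow> complex) \<Rightarrow> (nat \<Rightarrow> 'a) \<Rightarrow> real measure \<Rightarrow> bool" where
  "converges_in_distribution \<tau> a \<mu> \<longleftrightarrow>
     (\<forall>p::nat. integrable \<mu> (\<lambda>x. x ^ p) \<and>
        (\<lambda>n. \<tau> (a n ^ p)) \<longlonglongrightarrow> complex_of_real (\<integral>x. x ^ p \<partial>\<mu>))"

text \<open>Edges are two-element sets of vertices.\<close>

definition finite_simple_graph :: "'v set \<Rightarrow> 'v set set \<Rightarrow> bool" where
  "finite_simple_graph V E \<longleftrightarrow> finite V \<and> (\<forall>e\<in>E. e \<subseteq> V \<and> card e = 2)"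

definition classically_independent ::
    "('a::ring_1 \<Rightarrow> complex) \<Rightarrow> 'a set \<Rightarrow> 'a set \<Rightarrow> bool" where
  "classically_independent \<tau> A B \<longleftrightarrow>
     (\<forall>a\<in>A. \<forall>b\<in>B. a * b = b * a) \<and>
     (\<forall>a\<in>A. \<forall>b\<in>B. \<tau> a = 0 \<longrightarrow> \<tau> b = 0 \<longrightarrow> \<tau> (a * b) = 0)"

definition reduced_word :: "'v set set \<Rightarrow> 'v list \<Rightarrow> bool" where
  "reduced_word E is \<longleftrightarrow>
     (\<forall>j1 j2. j1 < j2 \<and> j2 < length is \<and> is ! j1 = is ! j2 \<longrightarrow>
        (\<exists>j3. j1 < j3 \<and> j3 < j2 \<and> {is ! j1, is ! j3} \<notin> E))"

definition graph_independent_algebras ::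
    "(complex \<Rightarrow> 'a::ring_1 \<Rightarrow> 'a) \<Rightarrow> ('a \<Rightarrow> complex) \<Rightarrow>
     'v set \<Rightarrow> 'v set set \<Rightarrow> ('v \<Rightarrow> 'a set) \<Rightarrow> bool" where
  "graph_independent_algebras smul \<tau> V E A \<longleftrightarrow>
     (\<forall>i\<in>V. unital_subalgebra smul (A i)) \<and>
     (\<forall>i j. {i, j} \<in> E \<longrightarrow> classically_independent \<tau> (A i) (A j)) \<and>
     (\<forall>is as. is \<noteq> [] \<and> set is \<subseteq> V \<and> reduced_word E is \<and> length as = length is \<and>
        (\<forall>j<length is. as ! j \<in> A (is ! j) \<and> \<tau> (as ! j) = 0) \<longrightarrow>
        \<tau> (prod_list as) = 0)"

definition graph_independent ::
    "(complex \<Rightarrow> 'a::ring_1 \<Rightarrow> 'a) \<Rightarrow> ('a \<Rightarrow> complex) \<Rightarrow>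
     'v set \<Rightarrow> 'v set set \<Rightarrow> ('v \<Rightarrow> 'a) \<Rightarrow> bool" where
  "graph_independent smul \<tau> V E a \<longleftrightarrow>
     graph_independent_algebras smul \<tau> V E (\<lambda>i. unital_subalgebra smul hull {a i})"

text \<open>A graphon is a function of two real variables of which only the values on the unit square
  matter; measurability is Lebesgue measurability there.\<close>

definition graphon :: "(real \<Rightarrow> real \<Rightarrow> real) \<Rightarrow> bool" where
  "graphon w \<longleftrightarrow>
     (\<lambda>(x, y). w x y) \<in> borel_measurable (lebesgue_on ({0..1} \<times> {0..1})) \<and>
     (\<forall>x\<in>{0..1}. \<forall>y\<in>{0..1}. w x y = w y x \<and> 0 \<le> w x y \<and> w x y \<le> 1)"

text \<open>The common value of \<open>w (x u) (x v)\<close> and \<open>w (x v) (x u)\<close> for an edge \<open>{u, v}\<close>; well defined by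
  symmetry of \<open>w\<close>.\<close>

definition edge_value :: "(real \<Rightarrow> real \<Rightarrow> real) \<Rightarrow> ('v \<Rightarrow> real) \<Rightarrow> 'v set \<Rightarrow> real" where
  "edge_value w x e = the_elem {w (x u) (x v) | u v. e = {u, v}}"

text \<open>The completion turns the product Borel measure into Lebesgue measure on the cube, so that the
  integrand is measurable for every Lebesgue measurable \<open>w\<close>.\<close>

definition graphon_density :: "'v set \<Rightarrow> 'v set set \<Rightarrow> (real \<Rightarrow> real \<Rightarrow> real) \<Rightarrow> real" where
  "graphon_density V E w =
     (\<integral>x. (\<Prod>e\<in>E. edge_value w x e)
        \<partial>completion (\<Pi>\<^sub>M v\<in>V. restrict_space lborel {0..1}))"

definition graph_homs ::
    "'v set \<Rightarrow> 'v set set \<Rightarrow> 'u set \<Rightarrow> 'u set set \<Rightarrow> ('v \<Rightarrow> 'u) set" where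
  "graph_homs V E W F = {\<phi> \<in> V \<rightarrow>\<^sub>E W. \<forall>u v. {u, v} \<in> E \<longrightarrow> {\<phi> u, \<phi> v} \<in> F}"

definition weighted_density ::
    "'v set \<Rightarrow> 'v set set \<Rightarrow> 'u set \<Rightarrow> 'u set set \<Rightarrow> ('u \<Rightarrow> real) \<Rightarrow> real" where
  "weighted_density V E W F \<alpha> =
     1 / (\<Sum>i\<in>W. \<alpha> i) ^ card V * (\<Sum>\<phi>\<in>graph_homs V E W F. \<Prod>v\<in>V. \<alpha> (\<phi> v))"

text \<open>Densities are invariant under isomorphism, so test graphs on finite sets of natural numbers
  account for all finite simple graphs.\<close>

definition converges_to_graphon ::
    "(nat \<Rightarrow> 'u set) \<Rightarrow> (nat \<Rightarrow> 'u set set) \<Rightarrow> (nat \<Rightarrow> 'u \<Rightarrow> real) \<Rightarrow>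
     (real \<Rightarrow> real \<Rightarrow> real) \<Rightarrow> bool" where
  "converges_to_graphon W F \<alpha> w \<longleftrightarrow>
     (\<forall>(V :: nat set) E. finite_simple_graph V E \<longrightarrow>
        (\<lambda>n. weighted_density V E (W n) (F n) (\<alpha> n)) \<longlonglongrightarrow> graphon_density V E w)"

definition pair_partitions :: "nat \<Rightarrow> nat set set set" where
  "pair_partitions p = {\<pi>. partition_on {1..p} \<pi> \<and> (\<forall>B\<in>\<pi>. card B = 2)}"

definition crossing :: "nat set \<Rightarrow> nat set \<Rightarrow> bool" where
  "crossing B C \<longleftrightarrow>
     (\<exists>i k j l. i < k \<and> k < j \<and> j < l \<and>
        ({i, j} \<subseteq> B \<and> {k, l} \<subseteq> C \<or> {i, j} \<subseteq> C \<and> {k, l} \<subseteq> B))"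

text \<open>The vertex set of the intersection graph of \<open>\<pi>\<close> is \<open>\<pi>\<close> itself.\<close>

definition intersection_edges :: "nat set set \<Rightarrow> nat set set set" where
  "intersection_edges \<pi> = {{B, C} | B C. B \<in> \<pi> \<and> C \<in> \<pi> \<and> B \<noteq> C \<and> crossing B C}"

text \<open>These moments satisfy Carleman's condition, since there are (2p-1)!! pair partitions and
  densities lie in [0,1]; hence for each graphon at most one measure has this property.\<close>

definition is_graphon_law :: "(real \<Rightarrow> real \<Rightarrow> real) \<Rightarrow> real measure \<Rightarrow> bool" where
  "is_graphon_law w \<mu> \<longleftrightarrow> real_distribution \<mu> \<and>
     (\<forall>p::nat. integrable \<mu> (\<lambda>x. x ^ p)) \<and>
     (\<forall>p::nat. odd p \<longrightarrow> (\<integral>x. x ^ p \<partial>\<mu>) = 0) \<and>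
     (\<forall>p\<ge>1. (\<integral>x. x ^ (2 * p) \<partial>\<mu>) =
        (\<Sum>\<pi>\<in>pair_partitions (2 * p). graphon_density \<pi> (intersection_edges \<pi>) w))"

end

theory Submission
  imports Defs "HOL-Library.Sublist"
begin

text \<open>The moment \<open>\<tau> (S\<^sub>n ^ p)\<close> is expanded over functions \<open>f : {1..p} \<rightarrow> {1..n}\<close>, grouped by
  their kernel \<open>\<pi>\<close>, so that the contribution of \<open>\<pi>\<close> is a sum over injections \<open>\<phi> : \<pi> \<rightarrow> {1..n}\<close>.
  A partition with a singleton block contributes nothing: the remaining letters can be rewritten as a
  combination of reduced centered words, and traciality puts the isolated letter in front of them.
  If all blocks have at least two elements and some block has more, Cauchy--Schwarz bounds the mixed moments
  by a constant times the product of the \<open>\<sigma>\<^sub>i\<close>, and the contribution is of the order of a positive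
  power of \<open>\<sigma>\<^sub>m\<^sub>a\<^sub>x\<^sup>2 / |\<sigma>\<^sup>2|\<close>. For a pair partition, commuting and centering shows
  that the mixed moment is the product of the variances if \<open>\<phi>\<close> is a homomorphism from the intersection graph
  and \<open>0\<close> otherwise; non-injective homomorphisms being negligible, the contribution converges to the
  density of the intersection graph in the graphon.\<close>

section \<open>Tracial states and bounds on mixed moments\<close>

context nc_prob_space
begin

lemma state_add: "\<tau> (x + y) = \<tau> x + \<tau> y"
  using state_linear by (simp add: Vector_Spaces.linear_iff)

lemma state_scale: "\<tau> (smul c x) = c * \<tau> x"
  using state_linear by (simp add: Vector_Spaces.linear_iff)

lemma smul_minus_one: "smul (- 1) x = - x"
  using scale_minus_left[of 1 x] by simp

lemma state_minus: "\<tau> (- x) = - \<tau> x"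
  using state_scale[of "- 1" x] by (simp add: smul_minus_one)

lemma state_diff: "\<tau> (x - y) = \<tau> x - \<tau> y"
  using state_add[of x "- y"] by (simp add: state_minus)

lemma state_zero: "\<tau> 0 = 0"
  using state_diff[of 0 0] by simp

lemma state_sum: "\<tau> (sum f A) = (\<Sum>x\<in>A. \<tau> (f x))"
  by (induction A rule: infinite_finite_induct) (auto simp: state_zero state_add)

lemma star_one: "star 1 = 1"
  by (metis mult_1 star_mult star_star mult.right_neutral)

lemma star_minus: "star (- x) = - star x"
  using star_scale[of "- 1" x] by (simp add: smul_minus_one)

lemma star_diff: "star (x - y) = star x - star y"
  using star_add[of x "- y"] by (simp add: star_minus)

lemma star_power: "star x = x \<Longrightarrow> star (x ^ n) = x ^ n"
  by (induction n) (auto simp: star_one star_mult power_commutes)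

lemma smul_mult_power: "(smul c x) ^ n = smul (c ^ n) (x ^ n)"
  by (induction n) (auto simp: scale_mult_left scale_mult_right mult.commute)

lemma prod_list_smul:
  "prod_list (map (\<lambda>i. smul (c i) (x i)) is) = smul (prod_list (map c is)) (prod_list (map x is))"
  by (induction "is") (auto simp: scale_mult_left scale_mult_right mult.commute)

lemma star_prod_list_rev:
  "(\<And>x. x \<in> set xs \<Longrightarrow> star x = x) \<Longrightarrow> star (prod_list xs) = prod_list (rev xs)"
  by (induction xs) (auto simp: star_one star_mult)

lemma state_star_mult_self: "Im (\<tau> (star x * x)) = 0" "0 \<le> Re (\<tau> (star x * x))"
  using state_pos[of x] by (auto simp: complex_nonneg_Reals_iff)

text \<open>Polarization: \<tau> is real at \<open>star z * z\<close> for z = x + y and for z = x +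
  i y. The first makes the imaginary parts of the two mixed terms opposite, the second makes their
  real parts equal.\<close>

lemma state_hermitian: "\<tau> (star y * x) = cnj (\<tau> (star x * y))"
proof (rule complex_eqI)
  have "Im (\<tau> (star (x + y) * (x + y))) = 0" "Im (\<tau> (star (x + smul \<i> y) * (x + smul \<i> y))) = 0"
    by (rule state_star_mult_self)+
  then show "Re (\<tau> (star y * x)) = Re (cnj (\<tau> (star x * y)))"
    and "Im (\<tau> (star y * x)) = Im (cnj (\<tau> (star x * y)))"
    using state_star_mult_self(1)[of x] state_star_mult_self(1)[of y]
    by (auto simp: star_add star_scale distrib_left distrib_right left_diff_distrib state_add state_diff
        state_scale scale_mult_left scale_mult_right)
qed

text \<open>Arithmetic-mean form of Cauchy-Schwarz: it follows from positivity at a single element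
  and involves no square roots, which suffices for bounds with unspecified constants.\<close>

lemma state_cauchy_schwarz_mean:
  "2 * norm (\<tau> (x * y)) \<le> norm (\<tau> (x * star x)) + norm (\<tau> (y * star y))"
proof (cases "\<tau> (x * y) = 0")
  case False
  \<comment> \<open>The phase \<open>l\<close> has modulus one and rotates \<open>c\<close> onto the
    positive axis, so that the cross terms of \<open>star z * z\<close> add up to
    \<open>- 2 * norm c\<close>.\<close>
  define c l where "c = \<tau> (x * y)" and "l = cnj (sgn c)"
  define z where "z = star x - smul l y"
  have l: "l * c = norm c"
  proof -
    have "c \<noteq> 0" using False by (simp add: c_def)
    moreover have "l * c = (complex_of_real (norm c))\<^sup>2 / norm c"
      by (simp only: complex_norm_square flip: of_real_power) (simp add: l_def sgn_eq mult.commute)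
    ultimately show ?thesis
      by (simp add: power2_eq_square)
  qed
  have ll: "cnj l * l = 1"
    using False complex_norm_square[of l] by (simp add: l_def c_def norm_sgn mult.commute)
  have h: "\<tau> (star y * star x) = cnj c"
    using state_hermitian[of y "star x"] by (simp add: c_def star_star)
  have "\<tau> (star z * z) = \<tau> (x * star x) - l * c - cnj (l * c) + cnj l * l * \<tau> (star y * y)"
    by (simp add: z_def star_diff star_star star_scale left_diff_distrib right_diff_distrib state_diff
        scale_mult_left scale_mult_right state_scale h c_def)
  also have "\<dots> = \<tau> (x * star x) + \<tau> (y * star y) - 2 * norm c"
    using l ll state_tracial[of y "star y"] by simp
  finally have "0 \<le> Re (\<tau> (x * star x)) + Re (\<tau> (y * star y)) - 2 * norm c"
    using state_star_mult_self(2)[of z] by simp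
  then show ?thesis
    using complex_Re_le_cmod[of "\<tau> (x * star x)"] complex_Re_le_cmod[of "\<tau> (y * star y)"]
    by (simp add: c_def)
qed simp

text \<open>In \<open>z * star z\<close> the two copies of \<open>q\<close> are neighbours, and
  traciality makes the two outer copies of \<open>p\<close> neighbours as well; two powers are
  saved.\<close>

lemma state_selfadjoint_run_square:
  assumes "star p = p" "star q = q" "\<And>x. x \<in> set xs \<Longrightarrow> star x = x"
  defines "z \<equiv> p * prod_list xs * q"
  shows "\<tau> (z * star z) = \<tau> (p\<^sup>2 * prod_list xs * q\<^sup>2 * prod_list (rev xs))"
  using state_tracial[of "p * prod_list xs * q * q * prod_list (rev xs)" p] assms(1,2)
  by (simp add: z_def star_mult star_prod_list_rev[OF assms(3)] mult.assoc power2_eq_square)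

text \<open>For a word \<open>u\<close> consisting of \<open>s \<ge> 2\<close> powers, \<open>u u\<^sup>*\<close> is up to cyclic rotation a word
  of \<open>2 s - 2\<close> powers, so Cauchy--Schwarz for a splitting in two halves decreases the number of powers.\<close>

lemma state_word_bounded:
  "\<exists>K\<ge>0. \<forall>ps :: ('a \<times> nat) list. length ps = r \<and>
     (\<forall>(x, k)\<in>set ps. star x = x \<and> (\<forall>j. norm (\<tau> (x ^ j)) \<le> (M j :: real)) \<and> k \<le> N) \<longrightarrow>
     norm (\<tau> (prod_list (map (\<lambda>(x, k). x ^ k) ps))) \<le> K"
\<comment> \<open>Merging doubles exponents, so the exponent bound \<open>N\<close> has to vary in
  the induction.\<close>
proof (induction r arbitrary: N rule: less_induct)
  case (less r)
  define W where "W = (\<lambda>ps :: ('a \<times> nat) list. prod_list (map (\<lambda>(x, k). x ^ k) ps))"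
  define ok where "ok = (\<lambda>m N (ps :: ('a \<times> nat) list). length ps = m \<and>
     (\<forall>(x, k)\<in>set ps. star x = x \<and> (\<forall>j. norm (\<tau> (x ^ j)) \<le> M j) \<and> k \<le> N))"
  have IH: "\<exists>K\<ge>0. \<forall>ps. ok m N' ps \<longrightarrow> norm (\<tau> (W ps)) \<le> K" if "m < r" for m N'
    using less.IH[OF that, of N'] unfolding ok_def W_def by blast
  have half: "\<exists>K\<ge>0. \<forall>ps. ok s N ps \<longrightarrow> norm (\<tau> (W ps * star (W ps))) \<le> K"
    if s: "1 \<le> s" "s < r" "2 * s - 2 < r" for s
  \<comment> \<open>A single power times its adjoint merges into one power, not into 2 s - 2 = 0
    powers.\<close>
  proof (cases "s = 1")
    case True
    with s IH[of 1 "2 * N"] obtain K where K: "0 \<le> K" "\<And>ps. ok 1 (2 * N) ps \<Longrightarrow> norm (\<tau> (W ps)) \<le> K"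
      by auto
    have "norm (\<tau> (W ps * star (W ps))) \<le> K" if ps: "ok s N ps" for ps
    proof -
      obtain x k where xk: "ps = [(x, k)]"
        using ps True by (cases ps) (auto simp: ok_def)
      have "W ps * star (W ps) = W [(x, 2 * k)]"
        using ps by (simp add: xk W_def ok_def star_power mult_2 power_add)
      moreover have "ok 1 (2 * N) [(x, 2 * k)]"
        using ps by (simp add: xk ok_def)
      ultimately show ?thesis using K(2) by metis
    qed
    with K(1) show ?thesis by blast
  next
    case False
    with s IH[of "2 * s - 2" "2 * N"] obtain K
      where K: "0 \<le> K" "\<And>ps. ok (2 * s - 2) (2 * N) ps \<Longrightarrow> norm (\<tau> (W ps)) \<le> K"
      by auto
    have "norm (\<tau> (W ps * star (W ps))) \<le> K" if ps: "ok s N ps" for ps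
    proof -
      from ps False s obtain x k qs where 1: "ps = (x, k) # qs" "qs \<noteq> []"
        by (cases ps) (auto simp: ok_def)
      then obtain y l ms where 2: "ps = (x, k) # ms @ [(y, l)]"
        by (cases qs rule: rev_cases) auto
      define ps' where "ps' = (x, 2 * k) # ms @ (y, 2 * l) # rev ms"
      have "\<tau> (W ps * star (W ps)) = \<tau> (W ps')"
      proof -
        have "star z = z" if "z \<in> set (map (\<lambda>(x, k). x ^ k) ms)" for z
          using that ps by (auto simp: 2 ok_def star_power)
        moreover have "star (x ^ k) = x ^ k" "star (y ^ l) = y ^ l"
          using ps by (auto simp: 2 ok_def star_power)
        ultimately show ?thesis
          using state_selfadjoint_run_square[of "x ^ k" "y ^ l" "map (\<lambda>(x, k). x ^ k) ms"]
          by (simp add: 2 W_def ps'_def mult.assoc rev_map power_even_eq)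
      qed
      moreover have "ok (2 * s - 2) (2 * N) ps'"
        using ps by (fastforce simp: 2 ok_def ps'_def)
      ultimately show ?thesis using K(2) by metis
    qed
    with K(1) show ?thesis by blast
  qed
  have "\<exists>K\<ge>0. \<forall>ps. ok r N ps \<longrightarrow> norm (\<tau> (W ps)) \<le> K"
  proof -
    consider "r = 0" | "r = 1" | "2 \<le> r" by linarith
    then show ?thesis
    proof cases
      case 1
      then show ?thesis
        by (intro exI[of _ 1]) (auto simp: ok_def W_def state_one)
    next
      case 2
      \<comment> \<open>The exponent is only known to be at most \<open>N\<close>; summing absolute
        values gives one nonnegative constant for all of them.\<close>
      have "norm (\<tau> (W ps)) \<le> (\<Sum>k\<le>N. \<bar>M k\<bar>)" if ps: "ok r N ps" for ps
      proof -
        obtain x k where xk: "ps = [(x, k)]"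
          using ps 2 by (cases ps) (auto simp: ok_def)
        have "norm (\<tau> (W ps)) \<le> \<bar>M k\<bar>"
          using ps abs_ge_self order_trans by (fastforce simp: xk W_def ok_def)
        also have "\<dots> \<le> (\<Sum>k\<le>N. \<bar>M k\<bar>)"
          using ps by (intro member_le_sum) (auto simp: xk ok_def)
        finally show ?thesis .
      qed
      then show ?thesis
        by (intro exI[of _ "\<Sum>k\<le>N. \<bar>M k\<bar>"]) (auto intro: sum_nonneg)
    next
      case 3
      \<comment> \<open>Even for the half rounded up, 2 s - 2 is at most r - 1; and r \<ge> 2 makes
        both halves nonempty and shorter than r.\<close>
      define s t where "s = (r + 1) div 2" and "t = r div 2"
      have st: "1 \<le> s" "s < r" "2 * s - 2 < r" "1 \<le> t" "t < r" "2 * t - 2 < r" "s + t = r"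
        using 3 by (auto simp: s_def t_def)
      obtain K1 where K1: "0 \<le> K1" "\<And>ps. ok s N ps \<Longrightarrow> norm (\<tau> (W ps * star (W ps))) \<le> K1"
        using half[OF st(1-3)] by blast
      obtain K2 where K2: "0 \<le> K2" "\<And>ps. ok t N ps \<Longrightarrow> norm (\<tau> (W ps * star (W ps))) \<le> K2"
        using half[OF st(4-6)] by blast
      have "norm (\<tau> (W ps)) \<le> K1 + K2" if ps: "ok r N ps" for ps
      proof -
        have "length (take s ps) = s" "length (drop s ps) = t"
          using ps st(7) by (auto simp: ok_def)
        then have "ok s N (take s ps)" "ok t N (drop s ps)"
          using ps set_take_subset[of s ps] set_drop_subset[of s ps] unfolding ok_def by blast+
        moreover have "W ps = W (take s ps) * W (drop s ps)"
          by (metis W_def append_take_drop_id map_append prod_list.append)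
        ultimately show ?thesis
          using state_cauchy_schwarz_mean[of "W (take s ps)" "W (drop s ps)"] K1 K2
          by (smt (verit))
      qed
      with K1(1) K2(1) show ?thesis by (intro exI[of _ "K1 + K2"]) auto
    qed
  qed
  then show ?case unfolding ok_def W_def by blast
qed

end

section \<open>Reduced words and pair words\<close>

lemma commute_prod_list:
  fixes x :: "'a::monoid_mult"
  assumes "\<And>y. y \<in> set ys \<Longrightarrow> x * y = y * x"
  shows "x * prod_list ys = prod_list ys * x"
  using assms
proof (induction ys)
  case (Cons y ys)
  then have "x * (y * prod_list ys) = y * (x * prod_list ys)"
    by (metis list.set_intros(1) mult.assoc)
  with Cons show ?case by (simp add: mult.assoc)
qed simp

text \<open>Equal letters at two positions become a splitting of the list, the form in which words
  are cut and merged below.\<close>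

lemma reduced_word_iff:
  "reduced_word E is \<longleftrightarrow>
     (\<forall>us i vs ws. is = us @ i # vs @ i # ws \<longrightarrow> (\<exists>j\<in>set vs. {i, j} \<notin> E))" (is "_ \<longleftrightarrow> ?R")
proof
  assume red: "reduced_word E is"
  show ?R
  proof (intro allI impI)
    fix us i vs ws assume eq: "is = us @ i # vs @ i # ws"
    let ?j = "length us" and ?k = "Suc (length us + length vs)"
    have "is ! ?j = i" "is ! ?k = i" "?j < ?k" "?k < length is"
      by (auto simp: eq nth_append)
    with red obtain l where l: "?j < l" "l < ?k" "{i, is ! l} \<notin> E"
      unfolding reduced_word_def by metis
    then have "is ! l = vs ! (l - Suc ?j)" "l - Suc ?j < length vs"
      by (auto simp: eq nth_append nth_Cons' Suc_diff_Suc)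
    with l(3) show "\<exists>j\<in>set vs. {i, j} \<notin> E"
      by (metis nth_mem)
  qed
next
  assume R: ?R
  show "reduced_word E is"
    unfolding reduced_word_def
  proof (intro allI impI)
    fix j k assume jk: "j < k \<and> k < length is \<and> is ! j = is ! k"
    define vs where "vs = take (k - Suc j) (drop (Suc j) is)"
    have "drop (Suc j) is = vs @ drop k is"
      using jk by (simp add: vs_def) (metis append_take_drop_id drop_drop Suc_leI le_add_diff_inverse2)
    then have "is = take j is @ is ! j # vs @ is ! j # drop (Suc k) is"
      using jk by (metis Cons_nth_drop_Suc id_take_nth_drop less_trans)
    with R obtain l where l: "l \<in> set vs" "{is ! j, l} \<notin> E"
      by metis
    then obtain m where "m < length vs" "l = vs ! m"
      by (metis in_set_conv_nth)
    with l(2) jk show "\<exists>l. j < l \<and> l < k \<and> {is ! j, is ! l} \<notin> E"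
      by (intro exI[of _ "Suc j + m"]) (auto simp: vs_def)
  qed
qed

lemma reduced_word_Cons:
  assumes "reduced_word E is" "i \<notin> set is"
  shows "reduced_word E (i # is)"
  using assms unfolding reduced_word_iff by (auto simp: Cons_eq_append_conv) blast

text \<open>The displayed occurrences of \<open>x\<close> are the only ones, so an embedded
  \<open>[x, z, x]\<close> has to use both of them.\<close>

lemma subseq_unique_occurrences:
  assumes "subseq [x, z, x] (us @ x # vs @ x # ws)" "x \<notin> set us" "x \<notin> set vs" "x \<notin> set ws" "z \<noteq> x"
  shows "z \<in> set vs"
proof -
  have 1: "subseq (x # ys) R" if "subseq (x # ys) (us @ R)" "x \<notin> set us" for ys us R
    using that by (induction us) (auto simp: list_emb_Cons_iff2)
  have "subseq [z, x] (vs @ x # ws)"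
    using 1[OF assms(1,2)] by simp
  then show ?thesis using assms(3)
  proof (induction vs)
    case Nil
    then show ?case using assms(4,5) by (auto dest: list_emb_set)
  qed (auto split: if_splits)
qed

text \<open>If every letter occurs exactly twice, the pattern \<open>x y x y\<close> says that the
  position pairs of \<open>x\<close> and \<open>y\<close> cross. Phrasing it by subsequences makes
  it easy to follow when letters are deleted.\<close>

definition crossings_adjacent :: "'v set set \<Rightarrow> 'v list \<Rightarrow> bool" where
  "crossings_adjacent E is \<longleftrightarrow> (\<forall>x y. x \<noteq> y \<longrightarrow> subseq [x, y, x, y] is \<longrightarrow> {x, y} \<in> E)"

text \<open>A crossing that involves \<open>x\<close> contains some \<open>x y x\<close>, which puts
  \<open>y\<close> between the two occurrences of \<open>x\<close> and hence makes it adjacent to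
  \<open>x\<close>. A crossing of two other letters survives the deletion.\<close>

lemma crossings_adjacent_remove:
  assumes is_eq: "is = us @ x # vs @ x # ws" and x: "x \<notin> set us" "x \<notin> set vs" "x \<notin> set ws"
    and adj: "\<And>y. y \<in> set vs \<Longrightarrow> {x, y} \<in> E"
  shows "crossings_adjacent E is \<longleftrightarrow> crossings_adjacent E (us @ vs @ ws)"
proof -
  have filt: "us @ vs @ ws = filter (\<lambda>y. y \<noteq> x) is"
  proof -
    have "filter (\<lambda>y. y \<noteq> x) xs = xs" if "x \<notin> set xs" for xs
      using that by (induction xs) auto
    with x show ?thesis by (simp add: is_eq)
  qed
  have "subseq [y, z, y, z] is \<Longrightarrow> {y, z} \<in> E"
    if C: "crossings_adjacent E (us @ vs @ ws)" and yz: "y \<noteq> z" for y z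
  proof -
    assume sub: "subseq [y, z, y, z] is"
    consider "y = x" | "z = x" | "y \<noteq> x" "z \<noteq> x" by blast
    then show "{y, z} \<in> E"
    proof cases
      case 1
      have "subseq [y, z, y] [y, z, y, z]" by simp
      then have "subseq [x, z, x] is" using sub subseq_order.trans 1 by metis
      then have "z \<in> set vs" using subseq_unique_occurrences x yz 1 unfolding is_eq by metis
      then show ?thesis using adj 1 by blast
    next
      case 2
      have "subseq [z, y, z] [y, z, y, z]" using yz by simp
      then have "subseq [x, y, x] is" using sub subseq_order.trans 2 by metis
      then have "y \<in> set vs" using subseq_unique_occurrences x yz 2 unfolding is_eq by metis
      then show ?thesis using adj 2 by (metis insert_commute)
    next
      case 3
      then have "subseq [y, z, y, z] (us @ vs @ ws)"
        using subseq_filter[OF sub, of "\<lambda>y. y \<noteq> x"] by (simp add: filt)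
      with C yz show ?thesis by (simp add: crossings_adjacent_def)
    qed
  qed
  moreover have "subseq ys (us @ vs @ ws) \<Longrightarrow> subseq ys is" for ys
    unfolding filt using subseq_filter_left subseq_order.trans by blast
  ultimately show ?thesis
    unfolding crossings_adjacent_def by blast
qed

text \<open>An innermost pair of equal letters is crossed by every letter between its two positions.\<close>

lemma reduced_pair_word_not_crossings_adjacent:
  assumes red: "reduced_word E is" and "is \<noteq> []" and two: "\<And>x. x \<in> set is \<Longrightarrow> count_list is x = 2"
  shows "\<not> crossings_adjacent E is"
proof
  assume C: "crossings_adjacent E is"
  \<comment> \<open>Descent on the gap between two equal letters: reducedness supplies a letter
    \<open>y\<close> in the gap that is not adjacent to \<open>x\<close>. Its second occurrence lies
    outside, giving a crossing of nonadjacent letters, or inside, giving a shorter gap.\<close>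
  have no_pair: False if "is = us @ x # vs @ x # ws" for us x vs ws
    using that
  proof (induction "length vs" arbitrary: us x vs ws rule: less_induct)
    case less
    from red less.prems obtain y where y: "y \<in> set vs" "{x, y} \<notin> E"
      unfolding reduced_word_iff by blast
    then obtain p q where vs: "vs = p @ y # q" by (meson split_list)
    have "x \<in> set is" "y \<in> set is"
      using y(1) by (auto simp: less.prems)
    then have cnt: "count_list is x = 2" "count_list is y = 2"
      by (simp_all add: two)
    have "x \<noteq> y"
      using cnt(1) by (auto simp: less.prems vs)
    consider "y \<in> set us" | "y \<in> set p" | "y \<in> set q" | "y \<in> set ws"
      using cnt(2) \<open>x \<noteq> y\<close> by (fastforce simp: less.prems vs count_list_0_iff)
    then show False
    proof cases
      case 1
      then obtain u1 u2 where "us = u1 @ y # u2" by (meson split_list)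
      then have "subseq [y, x, y, x] is"
        by (auto simp: less.prems vs intro!: list_emb_append2)
      with C \<open>x \<noteq> y\<close> y(2) show False by (metis crossings_adjacent_def insert_commute)
    next
      case 2
      then obtain u1 u2 where "p = u1 @ y # u2" by (meson split_list)
      then show False
        using less.hyps[of u2 "us @ x # u1" y "q @ x # ws"] by (simp add: less.prems vs)
    next
      case 3
      then obtain u1 u2 where "q = u1 @ y # u2" by (meson split_list)
      then show False
        using less.hyps[of u1 "us @ x # p" y "u2 @ x # ws"] by (simp add: less.prems vs)
    next
      case 4
      then obtain u1 u2 where "ws = u1 @ y # u2" by (meson split_list)
      then have "subseq [x, y, x, y] is"
        by (auto simp: less.prems vs intro!: list_emb_append2)
      with C \<open>x \<noteq> y\<close> y(2) show False by (simp add: crossings_adjacent_def)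
    qed
  qed
  obtain x xs where xs: "is = x # xs" using \<open>is \<noteq> []\<close> by (cases "is") auto
  then have "x \<in> set xs" using two[of x] count_list_0_iff[of xs x] by auto
  then obtain u v where "xs = u @ x # v" by (meson split_list)
  with no_pair[of "[]" x u v] xs show False by simp
qed

section \<open>Words in graph-independent elements\<close>

context nc_prob_space
begin

lemma centering_in_algebra:
  assumes "unital_subalgebra smul B" "x \<in> B"
  shows "x - smul c 1 \<in> B"
proof -
  have "x + smul (- c) 1 \<in> B"
    using assms unfolding unital_subalgebra_def by blast
  then show ?thesis by (simp add: scale_minus_left)
qed

text \<open>Centering the letters and merging equal ones which can be moved next to each other turns a
  word into a combination of reduced centered words, none of which contains the letter \<open>s\<close>.\<close>

lemma state_isolated_letter_front:
  assumes ind: "graph_independent_algebras smul \<tau> V E A"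
    and s: "s \<in> V" "b \<in> A s" "\<tau> b = 0"
    and ps: "\<forall>(i, x)\<in>set ps. i \<in> V \<and> i \<noteq> s \<and> x \<in> A i"
  shows "\<tau> (b * prod_list (map snd ps)) = 0"
  using ps
\<comment> \<open>The length is weighted by two because merging shortens the word by one letter but
  may create one uncentered letter. Centering removes an uncentered letter at equal length, or
  shortens the word.\<close>
proof (induction "2 * length ps + length (filter (\<lambda>(i, x). \<tau> x \<noteq> 0) ps)" arbitrary: ps rule: less_induct)
  case less
  have alg: "i \<in> V \<Longrightarrow> unital_subalgebra smul (A i)" for i
    using ind by (simp add: graph_independent_algebras_def)
  consider i x where "(i, x) \<in> set ps" "\<tau> x \<noteq> 0"
    | "\<forall>(i, x)\<in>set ps. \<tau> x = 0" "reduced_word E (map fst ps)"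
    | "\<forall>(i, x)\<in>set ps. \<tau> x = 0" "\<not> reduced_word E (map fst ps)"
    by fast
  then show ?case
  proof cases
    case 1
    then obtain us vs where eq: "ps = us @ (i, x) # vs" by (meson split_list)
    define x' where "x' = x - smul (\<tau> x) 1"
    have "\<tau> x' = 0" by (simp add: x'_def state_diff state_scale state_one)
    moreover have "x' \<in> A i"
      using less.prems alg centering_in_algebra by (auto simp: eq x'_def)
    ultimately have "\<tau> (b * prod_list (map snd (us @ (i, x') # vs))) = 0"
      "\<tau> (b * prod_list (map snd (us @ vs))) = 0"
      using less.prems 1(2) by (intro less.hyps; auto simp: eq)+
    moreover have "b * prod_list (map snd ps) =
       b * prod_list (map snd (us @ (i, x') # vs)) + smul (\<tau> x) (b * prod_list (map snd (us @ vs)))"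
      by (simp add: eq x'_def algebra_simps scale_mult_left scale_mult_right)
    ultimately show ?thesis by (simp add: state_add state_scale)
  next
    case 2
    \<comment> \<open>Since \<open>s\<close> differs from every letter of the word, prefixing it
      creates no new repetition, and independence applies to the longer word.\<close>
    let ?is = "s # map fst ps" and ?as = "b # map snd ps"
    have "reduced_word E ?is"
      using 2 less.prems by (intro reduced_word_Cons) auto
    moreover have "?as ! j \<in> A (?is ! j) \<and> \<tau> (?as ! j) = 0" if "j < length ?is" for j
    proof (cases j)
      case (Suc m)
      then have "ps ! m \<in> set ps" using that by simp
      then show ?thesis using 2 less.prems Suc that by (auto simp: split_beta)
    qed (use s in simp)
    moreover have "?is \<noteq> [] \<and> set ?is \<subseteq> V \<and> length ?as = length ?is"
      using less.prems s by auto
    ultimately have "\<tau> (prod_list ?as) = 0"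
      using ind unfolding graph_independent_algebras_def by blast
    then show ?thesis by simp
  next
    case 3
    then obtain us' i vs' ws' where "map fst ps = us' @ i # vs' @ i # ws'"
      and adj: "\<forall>j\<in>set vs'. {i, j} \<in> E"
      unfolding reduced_word_iff by blast
    then obtain us x vs y ws where eq: "ps = us @ (i, x) # vs @ (i, y) # ws" and vs': "vs' = map fst vs"
      by (auto simp: map_eq_append_conv append_eq_map_conv map_eq_Cons_conv Cons_eq_map_conv)
    \<comment> \<open>All letters between the two occurrences of \<open>i\<close> are adjacent to
      \<open>i\<close>, so \<open>x\<close> can travel to \<open>y\<close> and merge with
      it.\<close>
    have "x * prod_list (map snd vs) = prod_list (map snd vs) * x"
    proof (rule commute_prod_list)
      fix z assume "z \<in> set (map snd vs)"
      then obtain j where j: "(j, z) \<in> set vs" by auto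
      then have "{i, j} \<in> E" using adj vs' by force
      then have "classically_independent \<tau> (A i) (A j)"
        using ind by (simp add: graph_independent_algebras_def)
      then show "x * z = z * x"
        using less.prems j unfolding classically_independent_def eq by fastforce
    qed
    then have "prod_list (map snd ps) = prod_list (map snd (us @ vs @ (i, x * y) # ws))"
      by (simp add: eq mult.assoc[symmetric])
    moreover have "x * y \<in> A i"
      using less.prems alg by (auto simp: eq unital_subalgebra_def)
    then have "\<tau> (b * prod_list (map snd (us @ vs @ (i, x * y) # ws))) = 0"
      using less.prems by (intro less.hyps; auto simp: eq)
    ultimately show ?thesis by simp
  qed
qed

text \<open>Traciality rotates the word so that \<open>b\<close> stands first, followed by
  \<open>vs\<close> and then \<open>us\<close>.\<close>

lemma state_isolated_letter:
  assumes ind: "graph_independent_algebras smul \<tau> V E A"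
    and s: "s \<in> V" "b \<in> A s" "\<tau> b = 0"
    and "\<And>i. i \<in> set us \<union> set vs \<Longrightarrow> i \<in> V \<and> i \<noteq> s \<and> a i \<in> A i"
  shows "\<tau> (prod_list (map a us) * b * prod_list (map a vs)) = 0"
proof -
  have "\<tau> (b * prod_list (map snd (map (\<lambda>i. (i, a i)) (vs @ us)))) = 0"
    using assms(5) by (intro state_isolated_letter_front[OF ind s]) auto
  moreover have "\<tau> (prod_list (map a us) * b * prod_list (map a vs)) =
      \<tau> (b * prod_list (map a vs) * prod_list (map a us))"
    by (metis mult.assoc state_tracial)
  ultimately show ?thesis by (simp add: o_def mult.assoc)
qed

text \<open>A word that is not reduced has an equal pair that can be brought together. Its square is
  the variance plus a centered remainder; the remainder is isolated and contributes nothing, and the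
  variance leaves a shorter word. A nonempty reduced word has state 0, in agreement with the right
  side because it contains a crossing of nonadjacent letters.\<close>

lemma state_pair_word:
  assumes ind: "graph_independent_algebras smul \<tau> V E A"
    and a: "\<And>i. i \<in> V \<Longrightarrow> a i \<in> A i \<and> \<tau> (a i) = 0 \<and> \<tau> ((a i)\<^sup>2) = v i"
    and "set is \<subseteq> V" "\<And>i. i \<in> set is \<Longrightarrow> count_list is i = 2"
  shows "\<tau> (prod_list (map a is)) = (if crossings_adjacent E is then \<Prod>i\<in>set is. v i else 0)"
  using assms(3,4)
proof (induction "length is" arbitrary: "is" rule: less_induct)
  case less
  consider "is = []" | "is \<noteq> []" "reduced_word E is" | "\<not> reduced_word E is" by blast
  then show ?case
  proof cases
    case 1
    then show ?thesis by (simp add: state_one crossings_adjacent_def)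
  next
    case 2
    have "\<forall>j<length is. map a is ! j \<in> A (is ! j) \<and> \<tau> (map a is ! j) = 0"
      using a less.prems(1) by (auto simp: subset_iff)
    with 2 less.prems(1) ind have "\<tau> (prod_list (map a is)) = 0"
      unfolding graph_independent_algebras_def by (metis length_map)
    with 2 show ?thesis
      using reduced_pair_word_not_crossings_adjacent less.prems(2) by auto
  next
    case 3
    then obtain us x vs ws where eq: "is = us @ x # vs @ x # ws" and adj: "\<forall>y\<in>set vs. {x, y} \<in> E"
      unfolding reduced_word_iff by blast
    have x: "x \<in> V" "x \<notin> set us" "x \<notin> set vs" "x \<notin> set ws"
      using less.prems(1) less.prems(2)[of x] by (auto simp: eq count_list_0_iff)
    let ?P = "\<lambda>is. prod_list (map a is)"
    define b where "b = (a x)\<^sup>2 - smul (v x) 1"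
    have alg: "unital_subalgebra smul (A x)"
      using ind x(1) by (simp add: graph_independent_algebras_def)
    have "(a x)\<^sup>2 \<in> A x"
      using alg a[OF x(1)] by (auto simp: unital_subalgebra_def power2_eq_square)
    then have b: "b \<in> A x" "\<tau> b = 0"
      using a[OF x(1)] centering_in_algebra[OF alg]
      by (auto simp: b_def state_diff state_scale state_one)
    have "a x * ?P vs = ?P vs * a x"
    proof (rule commute_prod_list)
      fix z assume "z \<in> set (map a vs)"
      then obtain j where j: "j \<in> set vs" "z = a j" by auto
      then have "classically_independent \<tau> (A x) (A j)"
        using ind adj by (simp add: graph_independent_algebras_def)
      moreover have "j \<in> V" using j less.prems(1) by (auto simp: eq)
      ultimately show "a x * z = z * a x"
        using a x(1) j(2) unfolding classically_independent_def by blast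
    qed
    then have "?P is = ?P (us @ vs) * (a x)\<^sup>2 * ?P ws"
      by (simp add: eq power2_eq_square mult.assoc) (simp add: mult.assoc[symmetric])
    also have "\<dots> = ?P (us @ vs) * b * ?P ws + smul (v x) (?P (us @ vs @ ws))"
      by (simp add: b_def left_diff_distrib right_diff_distrib scale_mult_left scale_mult_right mult.assoc)
    finally have "\<tau> (?P is) = \<tau> (?P (us @ vs) * b * ?P ws) + v x * \<tau> (?P (us @ vs @ ws))"
      by (simp add: state_add state_scale)
    also have "\<tau> (?P (us @ vs) * b * ?P ws) = 0"
      using less.prems(1) a x by (intro state_isolated_letter[OF ind x(1) b]) (auto simp: eq)
    also have "\<tau> (?P (us @ vs @ ws)) =
        (if crossings_adjacent E (us @ vs @ ws) then \<Prod>i\<in>set (us @ vs @ ws). v i else 0)"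
    proof (rule less.hyps)
      fix i assume i: "i \<in> set (us @ vs @ ws)"
      then show "count_list (us @ vs @ ws) i = 2"
        using less.prems(2)[of i] x by (auto simp: eq split: if_splits)
    qed (use less.prems(1) in \<open>auto simp: eq\<close>)
    also have "crossings_adjacent E (us @ vs @ ws) \<longleftrightarrow> crossings_adjacent E is"
      using crossings_adjacent_remove[OF eq x(2-4), of E] adj by blast
    also have "set is = insert x (set (us @ vs @ ws))" by (auto simp: eq)
    then have "(\<Prod>i\<in>set is. v i) = v x * (\<Prod>i\<in>set (us @ vs @ ws). v i)"
      using x by simp
    ultimately show ?thesis by simp
  qed
qed

end

section \<open>Partitions and kernels of index functions\<close>

text \<open>Letters need not commute, so every function contributes an ordered product. The
  induction splits off the value at the last index, which matches multiplication on the
  right.\<close>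

lemma power_sum_expansion:
  fixes a :: "'k \<Rightarrow> 'a::semiring_1"
  assumes "finite K"
  shows "(\<Sum>k\<in>K. a k) ^ p = (\<Sum>f\<in>{1..p} \<rightarrow>\<^sub>E K. prod_list (map (\<lambda>j. a (f j)) [1..<Suc p]))"
proof (induction p)
  case (Suc p)
  have "(\<Sum>f\<in>{1..Suc p} \<rightarrow>\<^sub>E K. prod_list (map (\<lambda>j. a (f j)) [1..<Suc (Suc p)])) =
      (\<Sum>(y, g)\<in>K \<times> ({1..p} \<rightarrow>\<^sub>E K). prod_list (map (\<lambda>j. a ((g(Suc p := y)) j)) [1..<Suc (Suc p)]))"
  proof -
    have "{1..Suc p} = insert (Suc p) {1..p}" by auto
    then show ?thesis
      by (simp only: PiE_insert_eq) (subst sum.reindex, auto intro: inj_combinator simp: case_prod_beta o_def)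
  qed
  also have "\<dots> = (\<Sum>(y, g)\<in>K \<times> ({1..p} \<rightarrow>\<^sub>E K). prod_list (map (\<lambda>j. a (g j)) [1..<Suc p]) * a y)"
  proof (intro sum.cong refl, clarify)
    fix y g
    have "map (\<lambda>j. a ((g(Suc p := y)) j)) [1..<Suc p] = map (\<lambda>j. a (g j)) [1..<Suc p]"
      by (intro map_cong) auto
    moreover have "[1..<Suc (Suc p)] = [1..<Suc p] @ [Suc p]" by simp
    ultimately show "prod_list (map (\<lambda>j. a ((g(Suc p := y)) j)) [1..<Suc (Suc p)]) =
        prod_list (map (\<lambda>j. a (g j)) [1..<Suc p]) * a y"
      by (simp only: map_append prod_list.append) simp
  qed
  also have "\<dots> = (\<Sum>k\<in>K. a k) ^ p * (\<Sum>k\<in>K. a k)"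
    by (subst Suc.IH) (simp add: sum.cartesian_product[symmetric] sum_product sum.swap[of _ K])
  finally show ?case by (simp only: power_Suc2)
qed auto

definition block :: "'i set set \<Rightarrow> 'i \<Rightarrow> 'i set" where
  "block \<pi> j = (THE B. B \<in> \<pi> \<and> j \<in> B)"

lemma block_eq: "partition_on D \<pi> \<Longrightarrow> B \<in> \<pi> \<Longrightarrow> j \<in> B \<Longrightarrow> block \<pi> j = B"
  unfolding block_def by (rule the_equality) (auto simp: partition_on_def disjoint_def)

lemma block_in: "partition_on D \<pi> \<Longrightarrow> j \<in> D \<Longrightarrow> block \<pi> j \<in> \<pi> \<and> j \<in> block \<pi> j"
  using block_eq[of D \<pi> _ j] by (auto simp: partition_on_def)

text \<open>Each block enters once for every index it contains. The product along a word thus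
  becomes the product of powers that \<open>sum_injective_powers_le\<close> estimates.\<close>

lemma prod_block:
  assumes \<pi>: "partition_on D \<pi>" and "finite D"
  shows "(\<Prod>j\<in>D. g (block \<pi> j)) = (\<Prod>B\<in>\<pi>. g B ^ card B)"
proof -
  have "(\<Prod>j\<in>D. g (block \<pi> j)) = (\<Prod>B\<in>\<pi>. \<Prod>j\<in>B. g (block \<pi> j))"
    using \<pi> assms(2) by (subst partition_onD1[OF \<pi>], subst prod.Union_disjoint)
      (auto simp: partition_on_def disjoint_def intro: finite_subset)
  also have "\<dots> = (\<Prod>B\<in>\<pi>. g B ^ card B)"
    using block_eq[OF \<pi>] by (intro prod.cong refl) simp
  finally show ?thesis .
qed

text \<open>A function is determined by its partition into fibres and its value on each fibre;
  distinct fibres carry distinct values, which is the injectivity on the right.\<close>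

lemma sum_functions_by_kernel:
  fixes h :: "('i \<Rightarrow> 'k) \<Rightarrow> 'c::comm_monoid_add"
  assumes "finite D" "finite K"
  shows "(\<Sum>f\<in>D \<rightarrow>\<^sub>E K. h f) =
    (\<Sum>\<pi> | partition_on D \<pi>. \<Sum>\<phi> | \<phi> \<in> \<pi> \<rightarrow>\<^sub>E K \<and> inj_on \<phi> \<pi>. h (\<lambda>j\<in>D. \<phi> (block \<pi> j)))"
proof -
  have fin: "finite {\<pi>. partition_on D \<pi>}" by (rule finitely_many_partition_on[OF assms(1)])
  have fin': "finite {\<phi> \<in> \<pi> \<rightarrow>\<^sub>E K. inj_on \<phi> \<pi>}" if "partition_on D \<pi>" for \<pi>
    using finite_elements[OF assms(1) that] assms(2) by (simp add: finite_PiE)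
  \<comment> \<open>Only values attained on \<open>D\<close> are used, so that no fibre is
    empty.\<close>
  define ker where "ker = (\<lambda>f :: 'i \<Rightarrow> 'k. (\<lambda>k. {j \<in> D. f j = k}) ` (f ` D))"
  define S where "S = (SIGMA \<pi>:{\<pi>. partition_on D \<pi>}. {\<phi> \<in> \<pi> \<rightarrow>\<^sub>E K. inj_on \<phi> \<pi>})"
  have ker: "partition_on D (ker f)" for f
    by (rule partition_onI) (auto simp: ker_def disjnt_def)
  have "(\<Sum>f\<in>D \<rightarrow>\<^sub>E K. h f) = (\<Sum>(\<pi>, \<phi>)\<in>S. h (\<lambda>j\<in>D. \<phi> (block \<pi> j)))"
  proof (rule sum.reindex_bij_witness[where i = "\<lambda>(\<pi>, \<phi>). \<lambda>j\<in>D. \<phi> (block \<pi> j)"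
        and j = "\<lambda>f. (ker f, \<lambda>B\<in>ker f. the_elem (f ` B))"])
    fix f assume f: "f \<in> D \<rightarrow>\<^sub>E K"
    define \<phi> where "\<phi> = (\<lambda>B\<in>ker f. the_elem (f ` B))"
    have val: "\<phi> {j \<in> D. f j = f i} = f i" if "i \<in> D" for i
    proof -
      have "f ` {j \<in> D. f j = f i} = {f i}" using that by auto
      then show ?thesis using that by (auto simp: \<phi>_def ker_def)
    qed
    have blk: "block (ker f) i = {j \<in> D. f j = f i}" if "i \<in> D" for i
      using that by (intro block_eq[OF ker]) (auto simp: ker_def)
    show eq: "(case (ker f, \<lambda>B\<in>ker f. the_elem (f ` B)) of (\<pi>, \<phi>) \<Rightarrow> \<lambda>j\<in>D. \<phi> (block \<pi> j)) = f"
      using f by (auto simp: \<phi>_def[symmetric] blk val fun_eq_iff PiE_def extensional_def)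
    have "\<phi> \<in> ker f \<rightarrow>\<^sub>E K"
      using f val by (auto simp: \<phi>_def[symmetric] ker_def intro!: PiE_I) (simp add: \<phi>_def ker_def)
    moreover have "inj_on \<phi> (ker f)"
      using val by (auto simp: inj_on_def ker_def)
    ultimately show "(ker f, \<lambda>B\<in>ker f. the_elem (f ` B)) \<in> S"
      by (simp add: S_def ker \<phi>_def[symmetric])
    show "(case (ker f, \<lambda>B\<in>ker f. the_elem (f ` B)) of (\<pi>, \<phi>) \<Rightarrow> h (\<lambda>j\<in>D. \<phi> (block \<pi> j))) = h f"
      using eq by simp
  next
    fix p assume "p \<in> S"
    then obtain \<pi> \<phi> where p: "p = (\<pi>, \<phi>)" and \<pi>: "partition_on D \<pi>" and \<phi>: "\<phi> \<in> \<pi> \<rightarrow>\<^sub>E K" "inj_on \<phi> \<pi>"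
      by (auto simp: S_def)
    define f where "f = (\<lambda>j\<in>D. \<phi> (block \<pi> j))"
    have fB: "f ` B = {\<phi> B}" "{j \<in> D. f j = \<phi> B} = B" if "B \<in> \<pi>" for B
    proof -
      have BD: "B \<subseteq> D" "B \<noteq> {}" using \<pi> that by (auto simp: partition_on_def)
      have "f j = \<phi> B" if "j \<in> B" for j
        using that BD \<open>B \<in> \<pi>\<close> block_eq[OF \<pi>] by (auto simp: f_def)
      then show "f ` B = {\<phi> B}" using BD by auto
      have "j \<in> B" if "j \<in> D" "f j = \<phi> B" for j
        using that \<phi>(2) \<open>B \<in> \<pi>\<close> block_in[OF \<pi> that(1)] by (auto simp: f_def inj_on_def)
      with \<open>\<And>j. j \<in> B \<Longrightarrow> f j = \<phi> B\<close> BD show "{j \<in> D. f j = \<phi> B} = B" by auto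
    qed
    have "f ` D = \<phi> ` \<pi>"
      using fB(1) partition_onD1[OF \<pi>] by (auto simp: image_Union)
    then have "ker f = (\<lambda>k. {j \<in> D. f j = k}) ` (\<phi> ` \<pi>)"
      by (simp only: ker_def)
    then have kf: "ker f = \<pi>"
      using fB(2) by (simp add: image_image)
    have "(\<lambda>B\<in>\<pi>. the_elem (f ` B)) = \<phi>"
      using \<phi>(1) fB(1) by (auto simp: fun_eq_iff PiE_def extensional_def)
    then show "(\<lambda>f. (ker f, \<lambda>B\<in>ker f. the_elem (f ` B))) (case p of (\<pi>, \<phi>) \<Rightarrow> \<lambda>j\<in>D. \<phi> (block \<pi> j)) = p"
      by (simp add: p f_def[symmetric] kf)
    show "(case p of (\<pi>, \<phi>) \<Rightarrow> \<lambda>j\<in>D. \<phi> (block \<pi> j)) \<in> D \<rightarrow>\<^sub>E K"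
      using \<phi>(1) block_in[OF \<pi>] by (auto simp: p)
  qed
  also have "\<dots> = (\<Sum>\<pi> | partition_on D \<pi>. \<Sum>\<phi> | \<phi> \<in> \<pi> \<rightarrow>\<^sub>E K \<and> inj_on \<phi> \<pi>. h (\<lambda>j\<in>D. \<phi> (block \<pi> j)))"
    unfolding S_def using fin fin' by (intro sum.Sigma[symmetric]) auto
  finally show ?thesis .
qed

section \<open>Crossings and multiplicities in block words\<close>

lemma subseq_word_indices:
  assumes "subseq [x, y, x, y] (map f [1..<Suc p])"
  obtains i k j l where "i < k" "k < j" "j < l" "{i, k, j, l} \<subseteq> {1..p}"
    "f i = x" "f k = y" "f j = x" "f l = y"
proof -
  have "\<exists>N. [x, y, x, y] = map f (nths [1..<Suc p] N)"
    using assms unfolding subseq_conv_nths nths_map .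
  then obtain N where "[x, y, x, y] = map f (nths [1..<Suc p] N)" ..
  then obtain i k j l where ns: "nths [1..<Suc p] N = [i, k, j, l]"
    and f: "f i = x" "f k = y" "f j = x" "f l = y"
    unfolding Cons_eq_map_conv by auto
  have "sorted [i, k, j, l]" "distinct [i, k, j, l]"
    unfolding ns[symmetric] by (simp_all only: sorted_nths sorted_upt distinct_nthsI distinct_upt)
  then have "i < k" "k < j" "j < l" by auto
  moreover have "{i, k, j, l} \<subseteq> {1..p}"
    using set_nths_subset[of "[1..<Suc p]" N] unfolding ns by auto
  ultimately show thesis using that[of i k j l] f by blast
qed

text \<open>Injectivity gives different blocks different letters, so the alternating patterns in the
  word are exactly the crossings of blocks. Adjacency of crossing letters is then the homomorphism
  condition.\<close>

lemma crossings_adjacent_iff_graph_hom: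
  assumes \<pi>: "partition_on {1..p} \<pi>" and \<phi>: "\<phi> \<in> \<pi> \<rightarrow>\<^sub>E K" "inj_on \<phi> \<pi>"
  shows "crossings_adjacent F (map (\<lambda>j. \<phi> (block \<pi> j)) [1..<Suc p]) \<longleftrightarrow>
    \<phi> \<in> graph_homs \<pi> (intersection_edges \<pi>) K F" (is "crossings_adjacent F (map ?f _) \<longleftrightarrow> _")
proof
  assume C: "crossings_adjacent F (map ?f [1..<Suc p])"
  have adj: "{\<phi> B, \<phi> C} \<in> F"
    if "B \<in> \<pi>" "C \<in> \<pi>" "B \<noteq> C" "i < k" "k < j" "j < l" "{i, j} \<subseteq> B" "{k, l} \<subseteq> C" for B C i j k l
  proof -
    have "\<Union>\<pi> = {1..p}" using \<pi> by (simp add: partition_on_def)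
    then have "{i, j, k, l} \<subseteq> {1..p}" using that by blast
    then have "subseq [i, k, j, l] [1..<Suc p]"
      using that by (intro sorted_subset_imp_subseq) (auto simp del: upt_Suc)
    then have "subseq (map ?f [i, k, j, l]) (map ?f [1..<Suc p])"
      by (rule subseq_map)
    moreover have "map ?f [i, k, j, l] = [\<phi> B, \<phi> C, \<phi> B, \<phi> C]"
      using that block_eq[OF \<pi>] by simp
    moreover have "\<phi> B \<noteq> \<phi> C" using \<phi>(2) that by (auto simp: inj_on_def)
    ultimately show ?thesis using C unfolding crossings_adjacent_def by metis
  qed
  have "{\<phi> u, \<phi> v} \<in> F" if "{u, v} \<in> intersection_edges \<pi>" for u v
  proof -
    obtain B C where BC: "{u, v} = {B, C}" "B \<in> \<pi>" "C \<in> \<pi>" "B \<noteq> C" "crossing B C"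
      using \<open>{u, v} \<in> intersection_edges \<pi>\<close> by (auto simp: intersection_edges_def)
    then have "{\<phi> B, \<phi> C} \<in> F \<or> {\<phi> C, \<phi> B} \<in> F"
      unfolding crossing_def using adj by metis
    moreover have "\<phi> ` {u, v} = \<phi> ` {B, C}" by (simp only: BC(1))
    then have "{\<phi> u, \<phi> v} = {\<phi> B, \<phi> C}" by simp
    ultimately show ?thesis by (metis insert_commute)
  qed
  with \<phi>(1) show "\<phi> \<in> graph_homs \<pi> (intersection_edges \<pi>) K F"
    by (simp add: graph_homs_def)
next
  assume hom: "\<phi> \<in> graph_homs \<pi> (intersection_edges \<pi>) K F"
  show "crossings_adjacent F (map ?f [1..<Suc p])"
    unfolding crossings_adjacent_def
  proof (intro allI impI)
    fix x y assume "x \<noteq> y" "subseq [x, y, x, y] (map ?f [1..<Suc p])"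
    then obtain i k j l where o: "i < k" "k < j" "j < l" and D: "{i, k, j, l} \<subseteq> {1..p}"
      and f: "?f i = x" "?f k = y" "?f j = x" "?f l = y"
      by (elim subseq_word_indices)
    let ?B = "block \<pi> i" and ?C = "block \<pi> k"
    have in\<pi>: "block \<pi> m \<in> \<pi> \<and> m \<in> block \<pi> m" if "m \<in> {i, k, j, l}" for m
      using that D block_in[OF \<pi>] by blast
    have "block \<pi> j = ?B" "block \<pi> l = ?C" "?B \<noteq> ?C"
      using f \<phi>(2) in\<pi> \<open>x \<noteq> y\<close> unfolding inj_on_def by (metis insertCI)+
    then have "crossing ?B ?C"
      unfolding crossing_def using o in\<pi> by (metis bot_least insertCI insert_subset)
    then have "{?B, ?C} \<in> intersection_edges \<pi>"
      using in\<pi> \<open>?B \<noteq> ?C\<close> unfolding intersection_edges_def by blast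
    then show "{x, y} \<in> F" using hom f by (auto simp: graph_homs_def)
  qed
qed

text \<open>Injectivity makes the positions carrying the letter \<open>\<phi> B\<close> exactly the
  elements of \<open>B\<close>.\<close>

lemma count_list_block_word:
  assumes \<pi>: "partition_on {1..p} \<pi>" and \<phi>: "inj_on \<phi> \<pi>" and B: "B \<in> \<pi>"
  shows "count_list (map (\<lambda>j. \<phi> (block \<pi> j)) [1..<Suc p]) (\<phi> B) = card B"
proof -
  have BD: "B \<subseteq> {1..p}" using \<pi> B by (auto simp: partition_on_def)
  have "count_list (map f xs) y = length (filter (\<lambda>j. f j = y) xs)" for f :: "nat \<Rightarrow> 'a" and xs y
    by (induction xs) auto
  then have "count_list (map (\<lambda>j. \<phi> (block \<pi> j)) [1..<Suc p]) (\<phi> B) =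
      card (set (filter (\<lambda>j. \<phi> (block \<pi> j) = \<phi> B) [1..<Suc p]))"
    by (simp only: distinct_card distinct_filter distinct_upt)
  also have "set (filter (\<lambda>j. \<phi> (block \<pi> j) = \<phi> B) [1..<Suc p]) = B"
  proof -
    have "\<phi> (block \<pi> j) = \<phi> B \<longleftrightarrow> j \<in> B" if "j \<in> {1..p}" for j
      using block_in[OF \<pi> that] block_eq[OF \<pi> B, of j] \<phi> B by (metis inj_on_eq_iff)
    then show ?thesis
      using BD by (auto simp: atLeastLessThanSuc_atLeastAtMost simp del: upt_Suc)
  qed
  finally show ?thesis .
qed

lemma block_word_set:
  assumes \<pi>: "partition_on {1..p} \<pi>"
  shows "set (map (\<lambda>j. \<phi> (block \<pi> j)) [1..<Suc p]) = \<phi> ` \<pi>"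
proof -
  have "\<phi> B \<in> (\<lambda>j. \<phi> (block \<pi> j)) ` {1..p}" if "B \<in> \<pi>" for B
  proof -
    have "B \<noteq> {}" using partition_onD3[OF \<pi>] that by blast
    then obtain j where "j \<in> B" by blast
    then show ?thesis
      using that \<pi> block_eq[OF \<pi>] by (intro image_eqI[of _ _ j]) (auto simp: partition_on_def)
  qed
  then show ?thesis
    using block_in[OF \<pi>] by (auto simp: atLeastLessThanSuc_atLeastAtMost simp del: upt_Suc)
qed

text \<open>Union bound over the pairs on which \<phi> may collide: identifying two vertices leaves
  a surplus factor of at most \<epsilon>, and the remaining weights sum to 1.\<close>

lemma sum_noninjective_le:
  fixes s :: "'k \<Rightarrow> real" and \<epsilon> :: real
  assumes "finite K" "finite V" and s: "\<And>i. i \<in> K \<Longrightarrow> 0 \<le> s i \<and> s i \<le> \<epsilon>" and total: "sum s K = 1"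
  shows "(\<Sum>\<phi> | \<phi> \<in> V \<rightarrow>\<^sub>E K \<and> \<not> inj_on \<phi> V. \<Prod>v\<in>V. s (\<phi> v)) \<le> (card V)\<^sup>2 * \<epsilon>"
proof -
  let ?P = "\<lambda>V \<phi>. \<Prod>v\<in>V. s (\<phi> v)"
  have fin: "finite (V \<rightarrow>\<^sub>E K)" using assms by (simp add: finite_PiE)
  have nonneg: "0 \<le> ?P U \<phi>" if "\<phi> \<in> U \<rightarrow>\<^sub>E K" for \<phi> U
    using that s by (intro prod_nonneg) (auto simp: PiE_def Pi_def)
  have "K \<noteq> {}" using total by auto
  then have eps: "0 \<le> \<epsilon>" using s by force
  have pair: "(\<Sum>\<phi>\<in>V \<rightarrow>\<^sub>E K. if \<phi> u = \<phi> v then ?P V \<phi> else 0) \<le> \<epsilon>" if uv: "u \<in> V" "v \<in> V" "u \<noteq> v" for u v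
  proof -
    \<comment> \<open>The vertex \<open>u\<close> is split off: a collision forces its value to be
      \<open>g v\<close>, so only the sum over maps on \<open>U\<close> remains.\<close>
    define U where "U = V - {u}"
    have U: "V = insert u U" "u \<notin> U" "finite U" "v \<in> U" using uv assms by (auto simp: U_def)
    have "(\<Sum>\<phi>\<in>V \<rightarrow>\<^sub>E K. if \<phi> u = \<phi> v then ?P V \<phi> else 0) =
        (\<Sum>(y, g)\<in>K \<times> (U \<rightarrow>\<^sub>E K). if y = g v then s y * ?P U g else 0)"
      unfolding U(1) PiE_insert_eq
    proof (subst sum.reindex, rule inj_combinator[OF U(2)], intro sum.cong refl, clarify)
      fix y g
      have "?P U (g(u := y)) = ?P U g" for y using U(2) by (intro prod.cong) auto
      then show "((\<lambda>\<phi>. if \<phi> u = \<phi> v then ?P (insert u U) \<phi> else 0) \<circ> (\<lambda>(y, g). g(u := y))) (y, g) =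
          (if y = g v then s y * ?P U g else 0)"
        using U uv by (simp add: prod.insert)
    qed
    also have "\<dots> = (\<Sum>g\<in>U \<rightarrow>\<^sub>E K. \<Sum>y\<in>K. if y = g v then s y * ?P U g else 0)"
      by (subst sum.cartesian_product[symmetric], rule sum.swap)
    also have "\<dots> = (\<Sum>g\<in>U \<rightarrow>\<^sub>E K. s (g v) * ?P U g)"
      using U(4) assms(1) by (intro sum.cong refl) (auto simp: PiE_def Pi_def)
    also have "\<dots> \<le> (\<Sum>g\<in>U \<rightarrow>\<^sub>E K. \<epsilon> * ?P U g)"
      using s U(4) nonneg by (intro sum_mono mult_right_mono) (auto simp: PiE_def Pi_def)
    also have "\<dots> = \<epsilon> * (\<Prod>v\<in>U. sum s K)"
      using U(3) assms(1) by (subst prod_sum_PiE) (auto simp: sum_distrib_left)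
    finally show ?thesis by (simp add: total)
  qed
  have "(\<Sum>\<phi> | \<phi> \<in> V \<rightarrow>\<^sub>E K \<and> \<not> inj_on \<phi> V. ?P V \<phi>) \<le>
      (\<Sum>\<phi>\<in>V \<rightarrow>\<^sub>E K. \<Sum>(u, v)\<in>V \<times> V. if u \<noteq> v \<and> \<phi> u = \<phi> v then ?P V \<phi> else 0)"
  proof (rule order_trans[OF sum_mono sum_mono2])
    fix \<phi> assume \<phi>: "\<phi> \<in> {\<phi> \<in> V \<rightarrow>\<^sub>E K. \<not> inj_on \<phi> V}"
    then obtain u v where uv: "u \<in> V" "v \<in> V" "u \<noteq> v" "\<phi> u = \<phi> v" by (auto simp: inj_on_def)
    then have "?P V \<phi> = (case (u, v) of (u, v) \<Rightarrow> if u \<noteq> v \<and> \<phi> u = \<phi> v then ?P V \<phi> else 0)" by simp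
    also have "\<dots> \<le> (\<Sum>(u, v)\<in>V \<times> V. if u \<noteq> v \<and> \<phi> u = \<phi> v then ?P V \<phi> else 0)"
      using uv nonneg[of \<phi> V] \<phi> assms(2) by (intro member_le_sum) (auto split: if_splits)
    finally show "?P V \<phi> \<le> (\<Sum>(u, v)\<in>V \<times> V. if u \<noteq> v \<and> \<phi> u = \<phi> v then ?P V \<phi> else 0)" .
  qed (use fin nonneg in \<open>auto intro!: sum_nonneg\<close>)
  also have "\<dots> = (\<Sum>(u, v)\<in>V \<times> V. \<Sum>\<phi>\<in>V \<rightarrow>\<^sub>E K. if u \<noteq> v \<and> \<phi> u = \<phi> v then ?P V \<phi> else 0)"
    by (subst sum.swap) (simp add: case_prod_beta)
  \<comment> \<open>Diagonal pairs contribute 0 and are still counted with \<epsilon> \<ge> 0, which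
    gives the full square of the cardinality.\<close>
  also have "\<dots> \<le> (\<Sum>(u, v)\<in>V \<times> V. \<epsilon>)"
  proof (intro sum_mono, clarify)
    fix u v assume "u \<in> V" "v \<in> V"
    then show "(\<Sum>\<phi>\<in>V \<rightarrow>\<^sub>E K. if u \<noteq> v \<and> \<phi> u = \<phi> v then ?P V \<phi> else 0) \<le> \<epsilon>"
      using pair[of u v] eps by (cases "u = v") auto
  qed
  finally show ?thesis
    by (simp add: card_cartesian_product power2_eq_square)
qed

text \<open>Dropping injectivity only enlarges a sum of nonnegative terms, and the larger sum
  factors over the blocks. In each factor the squares sum to 1 and every further power costs at most
  \<delta>.\<close>

lemma sum_injective_powers_le:
  fixes t :: "'k \<Rightarrow> real"
  assumes fin: "finite K" "finite \<pi>" and t: "\<And>i. i \<in> K \<Longrightarrow> 0 \<le> t i \<and> t i \<le> \<delta>"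
    and total: "(\<Sum>i\<in>K. (t i)\<^sup>2) = 1" and m: "\<And>B. B \<in> \<pi> \<Longrightarrow> 2 \<le> m B"
  shows "(\<Sum>\<phi> | \<phi> \<in> \<pi> \<rightarrow>\<^sub>E K \<and> inj_on \<phi> \<pi>. \<Prod>B\<in>\<pi>. t (\<phi> B) ^ m B) \<le> (\<Prod>B\<in>\<pi>. \<delta> ^ (m B - 2))"
proof -
  have "(\<Sum>\<phi> | \<phi> \<in> \<pi> \<rightarrow>\<^sub>E K \<and> inj_on \<phi> \<pi>. \<Prod>B\<in>\<pi>. t (\<phi> B) ^ m B) \<le>
      (\<Sum>\<phi>\<in>\<pi> \<rightarrow>\<^sub>E K. \<Prod>B\<in>\<pi>. t (\<phi> B) ^ m B)"
  proof (rule sum_mono2)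
    fix \<phi> assume "\<phi> \<in> (\<pi> \<rightarrow>\<^sub>E K) - {\<phi> \<in> \<pi> \<rightarrow>\<^sub>E K. inj_on \<phi> \<pi>}"
    then show "0 \<le> (\<Prod>B\<in>\<pi>. t (\<phi> B) ^ m B)"
      using t by (intro prod_nonneg) (auto simp: PiE_def Pi_def)
  qed (use fin in \<open>auto intro: finite_PiE\<close>)
  also have "\<dots> = (\<Prod>B\<in>\<pi>. \<Sum>i\<in>K. t i ^ m B)"
    using fin by (simp add: prod_sum_PiE)
  also have "\<dots> \<le> (\<Prod>B\<in>\<pi>. \<delta> ^ (m B - 2))"
  proof (intro prod_mono conjI)
    fix B assume B: "B \<in> \<pi>"
    show "0 \<le> (\<Sum>i\<in>K. t i ^ m B)" using t by (intro sum_nonneg) auto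
    have "t i ^ m B \<le> \<delta> ^ (m B - 2) * (t i)\<^sup>2" if "i \<in> K" for i
    proof -
      have "t i ^ m B = t i ^ (m B - 2) * (t i)\<^sup>2"
        using m[OF B] by (metis le_add_diff_inverse2 power_add)
      also have "\<dots> \<le> \<delta> ^ (m B - 2) * (t i)\<^sup>2"
        using t[OF that] by (intro mult_right_mono power_mono) auto
      finally show ?thesis .
    qed
    then have "(\<Sum>i\<in>K. t i ^ m B) \<le> (\<Sum>i\<in>K. \<delta> ^ (m B - 2) * (t i)\<^sup>2)" by (rule sum_mono)
    then show "(\<Sum>i\<in>K. t i ^ m B) \<le> \<delta> ^ (m B - 2)"
      by (simp add: sum_distrib_left[symmetric] total)
  qed
  finally show ?thesis .
qed

section \<open>Graph densities under relabelling\<close>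

text \<open>Composition with \<beta>, and with its inverse on the image, gives a weight-preserving
  bijection between the two sets of homomorphisms.\<close>

lemma weighted_density_reindex:
  assumes inj: "inj_on \<beta> V" and E: "\<And>e. e \<in> E \<Longrightarrow> e \<subseteq> V"
  shows "weighted_density (\<beta> ` V) ((`) \<beta> ` E) W F \<alpha> = weighted_density V E W F \<alpha>"
proof -
  let ?g = "inv_into V \<beta>"
  have edge: "{u, v} \<in> (`) \<beta> ` E \<longleftrightarrow>
      (\<exists>u' v'. {u', v'} \<in> E \<and> u = \<beta> u' \<and> v = \<beta> v')" for u v
  proof
    assume "{u, v} \<in> (`) \<beta> ` E"
    then obtain e where e: "e \<in> E" "{u, v} = \<beta> ` e" by auto
    then obtain u' v' where uv: "u' \<in> e" "v' \<in> e" "u = \<beta> u'" "v = \<beta> v'"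
      by (metis imageE insertI1 insert_commute)
    have "\<beta> ` e = \<beta> ` {u', v'}" using e uv by simp
    moreover have "{u', v'} \<subseteq> V" using E[OF e(1)] uv by blast
    ultimately have "e = {u', v'}"
      using inj_on_image_eq_iff[OF inj E[OF e(1)]] by metis
    then show "\<exists>u' v'. {u', v'} \<in> E \<and> u = \<beta> u' \<and> v = \<beta> v'"
      using e(1) uv by blast
  next
    assume "\<exists>u' v'. {u', v'} \<in> E \<and> u = \<beta> u' \<and> v = \<beta> v'"
    then obtain u' v' where "{u', v'} \<in> E" "{u, v} = \<beta> ` {u', v'}" by auto
    then show "{u, v} \<in> (`) \<beta> ` E" by blast
  qed
  have "(\<Sum>\<phi>\<in>graph_homs (\<beta> ` V) ((`) \<beta> ` E) W F. \<Prod>v\<in>\<beta> ` V. \<alpha> (\<phi> v)) =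
      (\<Sum>\<phi>\<in>graph_homs V E W F. \<Prod>v\<in>V. \<alpha> (\<phi> v))"
  proof (rule sum.reindex_bij_witness[where j = "\<lambda>\<phi>. \<lambda>v\<in>V. \<phi> (\<beta> v)" and i = "\<lambda>\<phi>. \<lambda>u\<in>\<beta> ` V. \<phi> (?g u)"])
    fix \<phi> assume \<phi>: "\<phi> \<in> graph_homs (\<beta> ` V) ((`) \<beta> ` E) W F"
    have [simp]: "?g (\<beta> v) = v" if "v \<in> V" for v using inj that by simp
    show "(\<lambda>u\<in>\<beta> ` V. (\<lambda>v\<in>V. \<phi> (\<beta> v)) (?g u)) = \<phi>"
      using \<phi> by (auto simp: graph_homs_def fun_eq_iff PiE_def extensional_def)
    show "(\<lambda>v\<in>V. \<phi> (\<beta> v)) \<in> graph_homs V E W F"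
      using \<phi> E unfolding graph_homs_def edge by fastforce
    show "(\<Prod>v\<in>V. \<alpha> ((\<lambda>v\<in>V. \<phi> (\<beta> v)) v)) = (\<Prod>v\<in>\<beta> ` V. \<alpha> (\<phi> v))"
      by (simp add: prod.reindex[OF inj])
  next
    fix \<phi> assume \<phi>: "\<phi> \<in> graph_homs V E W F"
    have [simp]: "?g (\<beta> v) = v" if "v \<in> V" for v using inj that by simp
    show "(\<lambda>v\<in>V. (\<lambda>u\<in>\<beta> ` V. \<phi> (?g u)) (\<beta> v)) = \<phi>"
      using \<phi> by (auto simp: graph_homs_def fun_eq_iff PiE_def extensional_def)
    show "(\<lambda>u\<in>\<beta> ` V. \<phi> (?g u)) \<in> graph_homs (\<beta> ` V) ((`) \<beta> ` E) W F"
      unfolding graph_homs_def edge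
    proof (intro CollectI conjI allI impI)
      show "(\<lambda>u\<in>\<beta> ` V. \<phi> (?g u)) \<in> \<beta> ` V \<rightarrow>\<^sub>E W"
        using \<phi> by (auto simp: graph_homs_def)
      fix u v assume "\<exists>u' v'. {u', v'} \<in> E \<and> u = \<beta> u' \<and> v = \<beta> v'"
      then obtain u' v' where uv: "{u', v'} \<in> E" "u = \<beta> u'" "v = \<beta> v'" by blast
      moreover have "u' \<in> V" "v' \<in> V" using E[OF uv(1)] by auto
      moreover have "{\<phi> u', \<phi> v'} \<in> F" using uv(1) \<phi> by (simp add: graph_homs_def)
      ultimately show "{(\<lambda>u\<in>\<beta> ` V. \<phi> (?g u)) u, (\<lambda>u\<in>\<beta> ` V. \<phi> (?g u)) v} \<in> F" by simp
    qed
  qed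
  then show ?thesis by (simp only: weighted_density_def card_image[OF inj])
qed

text \<open>Preimages of null sets under a measure-preserving map are null, so the map stays
  measurable and measure preserving after completion.\<close>

lemma measurable_completion_distr:
  assumes "T \<in> M \<rightarrow>\<^sub>M N" "distr M N T = N"
  shows "T \<in> completion M \<rightarrow>\<^sub>M completion N"
    and "distr (completion M) (completion N) T = completion N"
proof -
  have T: "T \<in> completion M \<rightarrow>\<^sub>M N" "distr (completion M) N T = N"
    using assms by (auto simp: measurable_completion distr_completion)
  then show "T \<in> completion M \<rightarrow>\<^sub>M completion N"
    by (intro completion.measurable_completion2) auto
  show "distr (completion M) (completion N) T = completion N"
    using completion.completion_distr_eq[OF T(1)] T(2) by simp
qed

text \<open>For measurable \<open>f\<close> this is the change of variables along \<open>T\<close>.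
  Otherwise, composing with the measure-preserving right inverse \<open>S\<close> shows that
  \<open>f (T x)\<close> is not measurable in \<open>x\<close> either, and both integrals take the
  default value 0.\<close>

lemma integral_completion_isomorphism:
  fixes f :: "'b \<Rightarrow> real"
  assumes T: "T \<in> M \<rightarrow>\<^sub>M N" "distr M N T = N" and S: "S \<in> N \<rightarrow>\<^sub>M M" "distr N M S = M"
    and TS: "\<And>y. y \<in> space N \<Longrightarrow> T (S y) = y"
  shows "(\<integral>x. f (T x) \<partial>completion M) = (\<integral>y. f y \<partial>completion N)"
proof (cases "f \<in> borel_measurable (completion N)")
  case True
  then show ?thesis
    using integral_distr[OF measurable_completion_distr(1)[OF T] True]
    by (simp add: measurable_completion_distr(2)[OF T])
next
  case False
  have "(\<lambda>x. f (T x)) \<notin> borel_measurable (completion M)"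
  proof
    assume "(\<lambda>x. f (T x)) \<in> borel_measurable (completion M)"
    then have "(\<lambda>y. f (T (S y))) \<in> borel_measurable (completion N)"
      using measurable_compose[OF measurable_completion_distr(1)[OF S]] by blast
    then have "f \<in> borel_measurable (completion N)"
      using TS by (subst measurable_cong[where g = "\<lambda>y. f (T (S y))"]) auto
    with False show False by blast
  qed
  with False show ?thesis
    by (metis borel_measurable_integrable not_integrable_integral_eq)
qed

lemma edge_value_reindex:
  assumes inj: "inj_on \<beta> V" and "e \<subseteq> V"
  shows "edge_value w x (\<beta> ` e) = edge_value w (\<lambda>v. x (\<beta> v)) e"
proof -
  have "{w (x u) (x v) | u v. \<beta> ` e = {u, v}} = {w (x (\<beta> u)) (x (\<beta> v)) | u v. e = {u, v}}"
  proof (intro set_eqI iffI)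
    fix z assume "z \<in> {w (x u) (x v) | u v. \<beta> ` e = {u, v}}"
    then obtain u v where z: "z = w (x u) (x v)" "\<beta> ` e = {u, v}" by auto
    then obtain u' v' where uv: "u' \<in> e" "v' \<in> e" "u = \<beta> u'" "v = \<beta> v'"
      by (metis imageE insertI1 insert_commute)
    then have "\<beta> ` e = \<beta> ` {u', v'}" using z by simp
    moreover have "{u', v'} \<subseteq> V" using assms(2) uv by blast
    ultimately have "e = {u', v'}"
      using inj_on_image_eq_iff[OF inj assms(2)] by metis
    with z uv show "z \<in> {w (x (\<beta> u)) (x (\<beta> v)) | u v. e = {u, v}}" by auto
  next
    fix z assume "z \<in> {w (x (\<beta> u)) (x (\<beta> v)) | u v. e = {u, v}}"
    then show "z \<in> {w (x u) (x v) | u v. \<beta> ` e = {u, v}}" by auto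
  qed
  then show ?thesis by (simp only: edge_value_def)
qed

lemma edge_value_cong:
  assumes "\<And>v. v \<in> e \<Longrightarrow> x v = y v"
  shows "edge_value w x e = edge_value w y e"
proof -
  have "{w (x u) (x v) | u v. e = {u, v}} = {w (y u) (y v) | u v. e = {u, v}}"
  proof -
    have "w (x u) (x v) = w (y u) (y v)" if "e = {u, v}" for u v using assms that by auto
    then show ?thesis by (intro Collect_cong) metis
  qed
  then show ?thesis by (simp only: edge_value_def)
qed

text \<open>Renaming coordinates is a measure-preserving bijection between the two cubes, and it
  carries each edge factor to the factor of the renamed edge.\<close>

lemma graphon_density_reindex:
  assumes inj: "inj_on \<beta> V" and E: "\<And>e. e \<in> E \<Longrightarrow> e \<subseteq> V"
  shows "graphon_density (\<beta> ` V) ((`) \<beta> ` E) w = graphon_density V E w"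
proof -
  let ?U = "restrict_space lborel {0..1::real}"
  let ?M = "\<Pi>\<^sub>M u\<in>\<beta> ` V. ?U" and ?N = "\<Pi>\<^sub>M v\<in>V. ?U"
  let ?T = "\<lambda>x. \<lambda>v\<in>V. x (\<beta> v)" and ?S = "\<lambda>y. \<lambda>u\<in>\<beta> ` V. y (inv_into V \<beta> u)"
  have U: "prob_space ?U"
    by (rule prob_spaceI) (simp add: emeasure_restrict_space space_restrict_space)
  have T: "?T \<in> ?M \<rightarrow>\<^sub>M ?N" "distr ?M ?N ?T = ?N"
    using distr_PiM_reindex[of "\<beta> ` V" "\<lambda>_. ?U" \<beta> V] U inj
    by (auto intro!: measurable_restrict measurable_component_singleton)
  have S: "?S \<in> ?N \<rightarrow>\<^sub>M ?M" "distr ?N ?M ?S = ?M"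
    using distr_PiM_reindex[of V "\<lambda>_. ?U" "inv_into V \<beta>" "\<beta> ` V"] U inj_on_inv_into[of "\<beta> ` V" \<beta> V]
    by (auto intro!: measurable_restrict measurable_component_singleton simp: inv_into_into Pi_def)
  have TS: "?T (?S y) = y" if "y \<in> space ?N" for y
    using that inj by (auto simp: space_PiM PiE_def extensional_def fun_eq_iff)
  have "inj_on ((`) \<beta>) E"
    using inj E by (meson inj_on_image_eq_iff inj_onI)
  then have "(\<Prod>e\<in>(`) \<beta> ` E. edge_value w x e) = (\<Prod>e\<in>E. edge_value w (?T x) e)" for x
    using subsetD[OF E] E by (auto simp: prod.reindex edge_value_reindex[OF inj] intro!: prod.cong edge_value_cong)
  moreover have "(\<integral>x. (\<Prod>e\<in>E. edge_value w (?T x) e) \<partial>completion ?M) =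
      (\<integral>y. (\<Prod>e\<in>E. edge_value w y e) \<partial>completion ?N)"
    using TS by (rule integral_completion_isomorphism[OF T S])
  ultimately show ?thesis
    unfolding graphon_density_def by simp
qed

text \<open>The test graphs in \<open>converges_to_graphon\<close> have natural numbers as vertices.
  An injective numbering \<beta> gives access to other vertex types, in particular to intersection
  graphs, whose vertices are blocks.\<close>

lemma converges_to_graphon_finite_graph:
  fixes \<beta> :: "'v \<Rightarrow> nat"
  assumes conv: "converges_to_graphon W F \<alpha> w" and G: "finite_simple_graph V E" and inj: "inj_on \<beta> V"
  shows "(\<lambda>n. weighted_density V E (W n) (F n) (\<alpha> n)) \<longlonglongrightarrow> graphon_density V E w"
proof -
  have E: "e \<subseteq> V" if "e \<in> E" for e
    using G that by (auto simp: finite_simple_graph_def)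
  have "finite_simple_graph (\<beta> ` V) ((`) \<beta> ` E)"
    using G by (auto simp: finite_simple_graph_def card_image inj_on_subset[OF inj])
  with conv have "(\<lambda>n. weighted_density (\<beta> ` V) ((`) \<beta> ` E) (W n) (F n) (\<alpha> n))
      \<longlonglongrightarrow> graphon_density (\<beta> ` V) ((`) \<beta> ` E) w"
    unfolding converges_to_graphon_def by blast
  then show ?thesis
    by (simp only: weighted_density_reindex[of \<beta> V E, OF inj E] graphon_density_reindex[of \<beta> V E, OF inj E])
qed

section \<open>Contributions of the partitions\<close>

text \<open>The normalized weights have sum 1 and are at most \<epsilon>. The difference is the part
  from noninjective homomorphisms, bounded by the sum over all noninjective maps.\<close>

lemma weighted_density_injective_approx:
  fixes \<alpha> :: "'k \<Rightarrow> real" and \<epsilon> :: real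
  assumes fin: "finite K" "finite V" and \<alpha>: "\<And>i. i \<in> K \<Longrightarrow> 0 \<le> \<alpha> i \<and> \<alpha> i / sum \<alpha> K \<le> \<epsilon>"
    and S: "0 < sum \<alpha> K"
  shows "\<bar>weighted_density V E K F \<alpha> -
      1 / sum \<alpha> K ^ card V * (\<Sum>\<phi> | \<phi> \<in> graph_homs V E K F \<and> inj_on \<phi> V. \<Prod>v\<in>V. \<alpha> (\<phi> v))\<bar>
    \<le> (card V)\<^sup>2 * \<epsilon>"
proof -
  define s where "s = (\<lambda>i. \<alpha> i / sum \<alpha> K)"
  let ?P = "\<lambda>\<phi>. \<Prod>v\<in>V. s (\<phi> v)" and ?H = "graph_homs V E K F"
  have s: "i \<in> K \<Longrightarrow> 0 \<le> s i \<and> s i \<le> \<epsilon>" for i using \<alpha> S by (simp add: s_def)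
  have total: "sum s K = 1" using S by (simp add: s_def flip: sum_divide_distrib)
  have H: "?H \<subseteq> V \<rightarrow>\<^sub>E K" by (auto simp: graph_homs_def)
  have finH: "finite ?H" using H fin by (meson finite_PiE finite_subset)
  have nonneg: "0 \<le> ?P \<phi>" if "\<phi> \<in> V \<rightarrow>\<^sub>E K" for \<phi>
    using that s by (intro prod_nonneg) (auto simp: PiE_def Pi_def)
  have scale: "1 / sum \<alpha> K ^ card V * (\<Sum>\<phi>\<in>A. \<Prod>v\<in>V. \<alpha> (\<phi> v)) = (\<Sum>\<phi>\<in>A. ?P \<phi>)" for A
    by (simp add: s_def prod_dividef sum_divide_distrib)
  have "(\<Sum>\<phi>\<in>?H. ?P \<phi>) - (\<Sum>\<phi> | \<phi> \<in> ?H \<and> inj_on \<phi> V. ?P \<phi>) =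
      (\<Sum>\<phi>\<in>?H - {\<phi>. \<phi> \<in> ?H \<and> inj_on \<phi> V}. ?P \<phi>)"
    using finH by (intro sum_diff[symmetric]) auto
  moreover have "\<dots> \<le> (\<Sum>\<phi> | \<phi> \<in> V \<rightarrow>\<^sub>E K \<and> \<not> inj_on \<phi> V. ?P \<phi>)"
    using fin H nonneg by (intro sum_mono2) (auto simp: finite_PiE)
  moreover have "\<dots> \<le> (card V)\<^sup>2 * \<epsilon>"
    using sum_noninjective_le[OF fin s total] by simp
  moreover have "0 \<le> (\<Sum>\<phi>\<in>?H - {\<phi>. \<phi> \<in> ?H \<and> inj_on \<phi> V}. ?P \<phi>)"
    using nonneg H by (intro sum_nonneg) auto
  ultimately show ?thesis
    unfolding weighted_density_def scale by linarith
qed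

section \<open>Mixed moments along labelled partitions\<close>

context nc_prob_space
begin

text \<open>Dividing each letter by its \<sigma> makes the moment bounds uniform, so the bound for
  words of powers applies with all exponents equal to 1. Multilinearity restores the factors, and
  the constant depends only on \<open>p\<close> and \<open>M\<close>.\<close>

lemma state_word_scaled_bound:
  "\<exists>K\<ge>0. \<forall>(a :: 'k \<Rightarrow> 'a) \<sigma> is. length is = p \<longrightarrow>
     (\<forall>i\<in>set is. star (a i) = a i \<and> 0 < \<sigma> i \<and> (\<forall>j. norm (\<tau> (a i ^ j)) \<le> M j * \<sigma> i ^ j)) \<longrightarrow>
     norm (\<tau> (prod_list (map a is))) \<le> K * prod_list (map \<sigma> is)"
proof -
  obtain K where K: "0 \<le> K" "\<And>ps :: ('a \<times> nat) list. length ps = p \<Longrightarrow>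
     (\<forall>(x, k)\<in>set ps. star x = x \<and> (\<forall>j. norm (\<tau> (x ^ j)) \<le> M j) \<and> k \<le> 1) \<Longrightarrow>
     norm (\<tau> (prod_list (map (\<lambda>(x, k). x ^ k) ps))) \<le> K"
    using state_word_bounded[of p M 1] by blast
  have "norm (\<tau> (prod_list (map a is))) \<le> K * prod_list (map \<sigma> is)"
    if len: "length is = p"
      and a: "\<forall>i\<in>set is. star (a i) = a i \<and> 0 < \<sigma> i \<and> (\<forall>j. norm (\<tau> (a i ^ j)) \<le> M j * \<sigma> i ^ j)"
    for a :: "'k \<Rightarrow> 'a" and \<sigma> "is"
  proof -
    define b where "b = (\<lambda>i. smul (complex_of_real (1 / \<sigma> i)) (a i))"
    have "norm (\<tau> (prod_list (map b is))) \<le> K"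
    proof -
      have "star (b i) = b i \<and> norm (\<tau> (b i ^ j)) \<le> M j" if "i \<in> set is" for i j
      proof -
        have "0 < \<sigma> i" using a that by blast
        have "norm (\<tau> (b i ^ j)) = norm (\<tau> (a i ^ j)) / \<sigma> i ^ j"
          using \<open>0 < \<sigma> i\<close> by (simp add: b_def smul_mult_power state_scale norm_mult norm_power norm_divide power_divide)
        then show ?thesis
          using a that by (simp add: b_def star_scale divide_le_eq)
      qed
      then show ?thesis
        using K(2)[of "map (\<lambda>i. (b i, 1)) is"] len by (auto simp: o_def)
    qed
    moreover have "prod_list (map a is) =
        smul (prod_list (map (\<lambda>i. complex_of_real (\<sigma> i)) is)) (prod_list (map b is))"
    proof -
      have "map a is = map (\<lambda>i. smul (complex_of_real (\<sigma> i)) (b i)) is"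
        using a by (auto simp: b_def)
      then show ?thesis by (simp only: prod_list_smul)
    qed
    moreover have "norm (prod_list (map (\<lambda>i. complex_of_real (\<sigma> i)) is)) = prod_list (map \<sigma> is)"
      "0 \<le> prod_list (map \<sigma> is)"
      using a by (induction "is") (auto simp: norm_mult)
    ultimately show ?thesis
      by (simp add: state_scale norm_mult) (metis mult.commute mult_right_mono)
  qed
  with K(1) show ?thesis by blast
qed

text \<open>By injectivity the letter of a singleton block occurs only once in the word, so it is an
  isolated centered letter.\<close>

lemma state_block_word_singleton:
  assumes ind: "graph_independent_algebras smul \<tau> V E A"
    and a: "\<And>i. i \<in> V \<Longrightarrow> a i \<in> A i \<and> \<tau> (a i) = 0"
    and \<pi>: "partition_on {1..p} \<pi>" and \<phi>: "\<phi> \<in> \<pi> \<rightarrow>\<^sub>E V" "inj_on \<phi> \<pi>"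
    and B: "B \<in> \<pi>" "card B = 1"
  shows "\<tau> (prod_list (map a (map (\<lambda>j. \<phi> (block \<pi> j)) [1..<Suc p]))) = 0"
proof -
  let ?f = "\<lambda>j. \<phi> (block \<pi> j)"
  obtain j where j: "B = {j}" using B(2) by (auto simp: card_1_singleton_iff)
  have jp: "j \<in> {1..p}" using \<pi> B(1) j by (auto simp: partition_on_def)
  have fj: "?f j = \<phi> B" using block_eq[OF \<pi> B(1)] j by simp
  have split: "[1..<Suc p] = [1..<j] @ j # [Suc j..<Suc p]"
    using jp by (metis (no_types, lifting) One_nat_def Suc_leI atLeastAtMost_iff le_imp_less_Suc
        less_imp_le_nat upt_add_eq_append upt_conv_Cons le_Suc_ex)
  have other: "?f i \<in> V \<and> ?f i \<noteq> \<phi> B" if "i \<in> {1..p}" "i \<noteq> j" for i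
    using block_in[OF \<pi> that(1)] \<phi> B(1) j that(2) by (auto simp: inj_on_def)
  have "\<tau> (prod_list (map a (map ?f [1..<j])) * a (\<phi> B) * prod_list (map a (map ?f [Suc j..<Suc p]))) = 0"
  proof (rule state_isolated_letter[OF ind])
    show "\<phi> B \<in> V" using \<phi> B by auto
    then show "a (\<phi> B) \<in> A (\<phi> B)" "\<tau> (a (\<phi> B)) = 0" using a by auto
    fix i assume "i \<in> set (map ?f [1..<j]) \<union> set (map ?f [Suc j..<Suc p])"
    then obtain i' where "i = ?f i'" "i' \<in> {1..p}" "i' \<noteq> j" using jp by auto
    then show "i \<in> V \<and> i \<noteq> \<phi> B \<and> a i \<in> A i" using other a by auto
  qed
  then show ?thesis by (simp only: split map_append list.map prod_list.append prod_list.Cons fj mult.assoc)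
qed

text \<open>Every letter occurs exactly twice, so each mixed moment is the product of the variances
  times the indicator of the homomorphism condition.\<close>

lemma sum_state_pair_block_words:
  assumes ind: "graph_independent_algebras smul \<tau> V E A" and "finite V"
    and a: "\<And>i. i \<in> V \<Longrightarrow> a i \<in> A i \<and> \<tau> (a i) = 0 \<and> \<tau> ((a i)\<^sup>2) = v i"
    and \<pi>: "partition_on {1..p} \<pi>" "\<And>B. B \<in> \<pi> \<Longrightarrow> card B = 2"
  shows "(\<Sum>\<phi> | \<phi> \<in> \<pi> \<rightarrow>\<^sub>E V \<and> inj_on \<phi> \<pi>.
      \<tau> (prod_list (map a (map (\<lambda>j. \<phi> (block \<pi> j)) [1..<Suc p])))) =
    (\<Sum>\<phi> | \<phi> \<in> graph_homs \<pi> (intersection_edges \<pi>) V E \<and> inj_on \<phi> \<pi>. \<Prod>B\<in>\<pi>. v (\<phi> B))"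
proof -
  let ?I = "{\<phi>. \<phi> \<in> \<pi> \<rightarrow>\<^sub>E V \<and> inj_on \<phi> \<pi>}" and ?H = "graph_homs \<pi> (intersection_edges \<pi>) V E"
  have "finite (\<pi> \<rightarrow>\<^sub>E V)"
    using finite_elements[OF _ \<pi>(1)] assms(2) by (intro finite_PiE) auto
  then have finI: "finite ?I" by simp
  have "\<tau> (prod_list (map a (map (\<lambda>j. \<phi> (block \<pi> j)) [1..<Suc p]))) =
      (if \<phi> \<in> ?H then \<Prod>B\<in>\<pi>. v (\<phi> B) else 0)" if \<phi>: "\<phi> \<in> ?I" for \<phi>
  proof -
    let ?w = "map (\<lambda>j. \<phi> (block \<pi> j)) [1..<Suc p]"
    have w: "set ?w = \<phi> ` \<pi>" by (rule block_word_set[OF \<pi>(1)])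
    have "\<tau> (prod_list (map a ?w)) = (if crossings_adjacent E ?w then \<Prod>i\<in>set ?w. v i else 0)"
    proof (rule state_pair_word[OF ind a])
      show "set ?w \<subseteq> V" using \<phi> unfolding w by auto
      fix i assume "i \<in> set ?w"
      then obtain B where B: "B \<in> \<pi>" "i = \<phi> B" unfolding w by auto
      have "count_list ?w (\<phi> B) = card B"
        using \<phi> B(1) by (intro count_list_block_word[OF \<pi>(1)]) auto
      with B \<pi>(2) show "count_list ?w i = 2" by simp
    qed auto
    moreover have "crossings_adjacent E ?w \<longleftrightarrow> \<phi> \<in> ?H"
      using \<phi> by (intro crossings_adjacent_iff_graph_hom[OF \<pi>(1)]) auto
    moreover have "(\<Prod>i\<in>set ?w. v i) = (\<Prod>B\<in>\<pi>. v (\<phi> B))"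
      unfolding w using \<phi> by (simp add: prod.reindex)
    ultimately show ?thesis by simp
  qed
  then have "(\<Sum>\<phi>\<in>?I. \<tau> (prod_list (map a (map (\<lambda>j. \<phi> (block \<pi> j)) [1..<Suc p])))) =
      (\<Sum>\<phi>\<in>?I. if \<phi> \<in> ?H then \<Prod>B\<in>\<pi>. v (\<phi> B) else 0)"
    by (intro sum.cong refl) blast
  also have "\<dots> = (\<Sum>\<phi>\<in>{\<phi> \<in> ?I. \<phi> \<in> ?H}. \<Prod>B\<in>\<pi>. v (\<phi> B))"
    using finI by (rule sum.inter_filter[symmetric])
  also have "{\<phi> \<in> ?I. \<phi> \<in> ?H} = {\<phi>. \<phi> \<in> ?H \<and> inj_on \<phi> \<pi>}"
    by (auto simp: graph_homs_def)
  finally show ?thesis .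
qed

lemma state_power_sum_partitions:
  assumes "finite K"
  shows "\<tau> ((smul c (\<Sum>k\<in>K. a k)) ^ p) =
    (\<Sum>\<pi> | partition_on {1..p} \<pi>. c ^ p * (\<Sum>\<phi> | \<phi> \<in> \<pi> \<rightarrow>\<^sub>E K \<and> inj_on \<phi> \<pi>.
      \<tau> (prod_list (map a (map (\<lambda>j. \<phi> (block \<pi> j)) [1..<Suc p])))))"
proof -
  have restrict: "map (\<lambda>j. a ((\<lambda>j\<in>{1..p}. f j) j)) [1..<Suc p] = map a (map f [1..<Suc p])" for f
    by (simp add: o_def del: upt_Suc)
  have "\<tau> ((\<Sum>k\<in>K. a k) ^ p) = (\<Sum>f\<in>{1..p} \<rightarrow>\<^sub>E K. \<tau> (prod_list (map (\<lambda>j. a (f j)) [1..<Suc p])))"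
    by (simp only: power_sum_expansion[OF assms] state_sum)
  also have "\<dots> = (\<Sum>\<pi> | partition_on {1..p} \<pi>. \<Sum>\<phi> | \<phi> \<in> \<pi> \<rightarrow>\<^sub>E K \<and> inj_on \<phi> \<pi>.
      \<tau> (prod_list (map a (map (\<lambda>j. \<phi> (block \<pi> j)) [1..<Suc p]))))"
    by (subst sum_functions_by_kernel[OF _ assms]) (simp_all only: restrict finite_atLeastAtMost)
  finally show ?thesis
    by (simp only: smul_mult_power state_scale sum_distrib_left)
qed

end

section \<open>Limit of the moments\<close>

lemma prod_list_map_upt: "prod_list (map f [1..<Suc p]) = (\<Prod>j\<in>{1..p}. f j :: 'b::comm_monoid_mult)"
  by (simp only: prod.distinct_set_conv_list[symmetric] distinct_upt set_upt atLeastLessThanSuc_atLeastAtMost)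

lemma partition_card_sum:
  assumes "partition_on {1..p} \<pi>"
  shows "(\<Sum>B\<in>\<pi>. card B) = p"
proof -
  have "card (\<Union>\<pi>) = (\<Sum>B\<in>\<pi>. card B)"
  proof (rule card_Union_disjoint)
    show "disjoint \<pi>" by (rule partition_onD2[OF assms])
    show "finite B" if "B \<in> \<pi>" for B
      using that partition_onD1[OF assms] by (metis Union_upper finite_atLeastAtMost finite_subset)
  qed
  then show ?thesis using arg_cong[OF partition_onD1[OF assms], of card] by simp
qed

text \<open>Odd and even moments take one form, matched to the sum over all partitions: a pair
  partition of \<open>{1..p}\<close> forces \<open>p\<close> to be even, so for odd \<open>p\<close>
  every summand is 0.\<close>

lemma graphon_law_moment:
  assumes "is_graphon_law w \<mu>" and "p \<ge> 1"
  shows "(\<integral>x. x ^ p \<partial>\<mu>) = (\<Sum>\<pi> | partition_on {1..p} \<pi>.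
    if \<forall>B\<in>\<pi>. card B = 2 then graphon_density \<pi> (intersection_edges \<pi>) w else 0)"
proof -
  have fin: "finite {\<pi>. partition_on {1..p} \<pi>}" by (rule finitely_many_partition_on) simp
  have "(\<Sum>\<pi> | partition_on {1..p} \<pi>.
      if \<forall>B\<in>\<pi>. card B = 2 then graphon_density \<pi> (intersection_edges \<pi>) w else 0) =
    (\<Sum>\<pi>\<in>pair_partitions p. graphon_density \<pi> (intersection_edges \<pi>) w)"
    unfolding pair_partitions_def by (subst sum.inter_filter[OF fin, symmetric]) simp
  moreover have "pair_partitions p = {}" if "odd p"
  proof -
    have "p = 2 * card \<pi>" if "\<pi> \<in> pair_partitions p" for \<pi>
      using that partition_card_sum[of p \<pi>] by (simp add: pair_partitions_def)
    with \<open>odd p\<close> show ?thesis by fastforce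
  qed
  moreover have "(\<integral>x. x ^ p \<partial>\<mu>) = (\<Sum>\<pi>\<in>pair_partitions p. graphon_density \<pi> (intersection_edges \<pi>) w)"
    if "even p"
  proof -
    from that obtain q where "p = 2 * q" by (rule evenE)
    with assms show ?thesis by (simp add: is_graphon_law_def)
  qed
  ultimately show ?thesis
    using assms by (cases "even p") (auto simp: is_graphon_law_def)
qed

theorem theorem4p2:
  fixes smul :: "complex \<Rightarrow> 'a::ring_1 \<Rightarrow> 'a"
    and star :: "'a \<Rightarrow> 'a"
    and \<tau> :: "'a \<Rightarrow> complex"
    and \<sigma> :: "nat \<Rightarrow> real"
    and G :: "nat \<Rightarrow> nat set set"
    and w :: "real \<Rightarrow> real \<Rightarrow> real"
    and a :: "nat \<Rightarrow> nat \<Rightarrow> 'a"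
    and C :: "nat \<Rightarrow> real"
    and \<mu> :: "real measure"
  assumes "nc_prob_space smul star \<tau>"
    and "\<And>k. 1 \<le> k \<Longrightarrow> 0 < \<sigma> k"
    and "\<And>n. 1 \<le> n \<Longrightarrow> finite_simple_graph {1..n} (G n)"
    and "graphon w"
    and "converges_to_graphon (\<lambda>n. {1..n}) G (\<lambda>n k. (\<sigma> k)\<^sup>2) w"
    and "filterlim (\<lambda>n. \<Sum>i\<in>{1..n}. (\<sigma> i)\<^sup>2) at_top sequentially"
    and "(\<lambda>n. Max ((\<lambda>i. (\<sigma> i)\<^sup>2) ` {1..n}) / (\<Sum>i\<in>{1..n}. (\<sigma> i)\<^sup>2)) \<longlonglongrightarrow> 0"
    and "\<And>n. 1 \<le> n \<Longrightarrow> graph_independent smul \<tau> {1..n} (G n) (a n)"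
    and "\<And>n k. k \<in> {1..n} \<Longrightarrow> star (a n k) = a n k"
    and "\<And>n k. k \<in> {1..n} \<Longrightarrow> \<tau> (a n k) = 0"
    and "\<And>n k. k \<in> {1..n} \<Longrightarrow> \<tau> ((a n k)\<^sup>2) = complex_of_real ((\<sigma> k)\<^sup>2)"
    and "\<And>p. 1 \<le> p \<Longrightarrow> 1 \<le> C p"
    and "\<And>n k. k \<in> {1..n} \<Longrightarrow>
           \<exists>\<nu>. is_distribution_of \<tau> (a n k) \<nu> \<and>
               (\<forall>p\<ge>1. (\<integral>x. \<bar>x\<bar> ^ p \<partial>\<nu>) \<le> C p * \<sigma> k ^ p)"
    and "is_graphon_law w \<mu>"
  shows "converges_in_distribution \<tau>
           (\<lambda>n. smul (complex_of_real (1 / sqrt (\<Sum>i\<in>{1..n}. (\<sigma> i)\<^sup>2))) (\<Sum>k\<in>{1..n}. a n k)) \<mu>"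
proof -
  interpret nc_prob_space smul star \<tau> by (rule assms(1))
  define S c \<epsilon> where "S = (\<lambda>n. \<Sum>i\<in>{1..n}. (\<sigma> i)\<^sup>2)" and "c = (\<lambda>n. 1 / sqrt (S n))"
    and "\<epsilon> = (\<lambda>n. Max ((\<lambda>i. (\<sigma> i)\<^sup>2) ` {1..n}) / S n)"
  define A where "A = (\<lambda>n i. unital_subalgebra smul hull {a n i})"
  have ind: "graph_independent_algebras smul \<tau> {1..n} (G n) (A n)" if "1 \<le> n" for n
    using assms(8)[OF that] by (simp add: graph_independent_def A_def)
  have aA: "a n i \<in> A n i" for n i
    by (simp add: A_def hull_inc)
  \<comment> \<open>For \<open>n = 0\<close> the sum is empty and equals 0, so the estimates start
    at \<open>n = 1\<close>.\<close>
  have Spos: "0 < S n" if "1 \<le> n" for n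
    unfolding S_def using assms(2) that by (intro sum_pos zero_less_power) auto
  have eps: "(\<sigma> i)\<^sup>2 / S n \<le> \<epsilon> n" if "i \<in> {1..n}" for n i
    unfolding \<epsilon>_def using that Spos[of n] by (intro divide_right_mono Max_ge) auto
  have eps_lim: "\<epsilon> \<longlonglongrightarrow> 0"
    using assms(7) by (simp add: \<epsilon>_def S_def)
  have csq: "(c n)\<^sup>2 = 1 / S n" and cpos: "0 < c n" if "1 \<le> n" for n
    using Spos[OF that] by (simp_all add: c_def power_divide)
  \<comment> \<open>The constants \<open>C\<close> are controlled at positive exponents; the zeroth
    moment is \<open>\<tau> 1 = 1\<close>.\<close>
  define M where "M = (\<lambda>j :: nat. if j = 0 then 1 else C j)"
  have mom: "norm (\<tau> (a n k ^ j)) \<le> M j * \<sigma> k ^ j" if k: "k \<in> {1..n}" for n k j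
  proof (cases "j = 0")
    case False
    obtain \<nu> where \<nu>: "is_distribution_of \<tau> (a n k) \<nu>" "\<forall>p\<ge>1. (\<integral>x. \<bar>x\<bar> ^ p \<partial>\<nu>) \<le> C p * \<sigma> k ^ p"
      using assms(13)[OF k] by blast
    have "norm (\<tau> (a n k ^ j)) = \<bar>\<integral>x. x ^ j \<partial>\<nu>\<bar>"
      using \<nu>(1) by (simp add: is_distribution_of_def)
    also have "\<dots> \<le> (\<integral>x. \<bar>x\<bar> ^ j \<partial>\<nu>)"
      using integral_abs_bound[of \<nu> "\<lambda>x. x ^ j"] by (simp add: power_abs)
    also have "\<dots> \<le> M j * \<sigma> k ^ j"
      using \<nu>(2) False by (simp add: M_def)
    finally show ?thesis .
  qed (simp add: M_def state_one)
  have int: "integrable \<mu> (\<lambda>x. x ^ p)" and \<mu>: "prob_space \<mu>" for p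
    using assms(14) by (auto simp: is_graphon_law_def real_distribution_def)
  have "(\<lambda>n. \<tau> (smul (complex_of_real (c n)) (\<Sum>k\<in>{1..n}. a n k) ^ p)) \<longlonglongrightarrow> complex_of_real (\<integral>x. x ^ p \<partial>\<mu>)" for p
  \<comment> \<open>The partition formula for the moments of \<mu> starts at p = 1; both zeroth
    moments are the total mass 1.\<close>
  proof (cases "p = 0")
    case True
    then show ?thesis using prob_space.prob_space[OF \<mu>] by (simp add: state_one)
  next
    case False
    \<comment> \<open>\<open>T n \<pi>\<close> is the contribution of \<pi> to the moment and
      \<open>L \<pi>\<close> its limit; the cases below are distinguished by block sizes.\<close>
    define L where "L = (\<lambda>\<pi>. if \<forall>B\<in>\<pi>. card B = 2 then graphon_density \<pi> (intersection_edges \<pi>) w else 0)"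
    define h where "h = (\<lambda>n \<pi> \<phi>. \<tau> (prod_list (map (a n) (map (\<lambda>j. \<phi> (block \<pi> j)) [1..<Suc p]))))"
    define I where "I = (\<lambda>(n :: nat) \<pi>. {\<phi>. \<phi> \<in> \<pi> \<rightarrow>\<^sub>E {1..n} \<and> inj_on \<phi> (\<pi> :: nat set set)})"
    define T where "T = (\<lambda>n \<pi>. complex_of_real (c n) ^ p * (\<Sum>\<phi>\<in>I n \<pi>. h n \<pi> \<phi>))"
    have "(\<lambda>n. T n \<pi>) \<longlonglongrightarrow> complex_of_real (L \<pi>)" if \<pi>: "partition_on {1..p} \<pi>" for \<pi>
    proof -
      have fin\<pi>: "finite \<pi>" by (rule finite_elements[OF _ \<pi>]) simp
      have cardB: "1 \<le> card B" if "B \<in> \<pi>" for B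
      proof -
        have "B \<subseteq> {1..p}" "B \<noteq> {}" using \<pi> that by (auto simp: partition_on_def)
        then show ?thesis by (metis One_nat_def Suc_leI card_gt_0_iff finite_atLeastAtMost finite_subset)
      qed
      consider B where "B \<in> \<pi>" "card B = 1"
        | D where "\<And>B. B \<in> \<pi> \<Longrightarrow> 2 \<le> card B" "D \<in> \<pi>" "2 < card D"
        | "\<And>B. B \<in> \<pi> \<Longrightarrow> card B = 2"
        using cardB by (metis One_nat_def Suc_1 Suc_leI le_neq_implies_less)
      then show ?thesis
      proof cases
        case (1 B)
        have "T n \<pi> = 0" if "1 \<le> n" for n
          using state_block_word_singleton[OF ind[OF that] _ \<pi> _ _ 1, of "a n"] aA assms(10)
          by (simp add: T_def I_def h_def)
        then have "eventually (\<lambda>n. T n \<pi> = 0) sequentially"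
          by (rule eventually_sequentiallyI)
        moreover have "L \<pi> = 0" using 1 by (auto simp: L_def)
        ultimately show ?thesis by (simp add: tendsto_eventually)
      next
        case (2 D)
        obtain K where K: "0 \<le> K" "\<And>a \<sigma> is. length is = p \<Longrightarrow>
          (\<forall>i\<in>set is. star (a i) = a i \<and> 0 < \<sigma> i \<and> (\<forall>j. norm (\<tau> (a i ^ j)) \<le> M j * \<sigma> i ^ j)) \<Longrightarrow>
          norm (\<tau> (prod_list (map a (is :: nat list)))) \<le> K * prod_list (map \<sigma> is)"
          using state_word_scaled_bound[where ?'k = nat, of p M] by blast
        have bound: "norm (T n \<pi>) \<le> K * (\<Prod>B\<in>\<pi>. sqrt (\<epsilon> n) ^ (card B - 2))" if n: "1 \<le> n" for n
        proof -
          \<comment> \<open>Normalized standard deviations: their squares sum to 1 and each is at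
            most \<open>sqrt (\<epsilon> n)\<close>. The \<open>p\<close> factors \<open>c n\<close>
            are distributed over the \<open>p\<close> letters.\<close>
          define t where "t = (\<lambda>i. c n * \<sigma> i)"
          have tsq: "(t i)\<^sup>2 = (\<sigma> i)\<^sup>2 / S n" for i
            by (simp add: t_def power_mult_distrib csq[OF n])
          have t: "0 \<le> t i \<and> t i \<le> sqrt (\<epsilon> n)" if "i \<in> {1..n}" for i
            using that eps[OF that] assms(2)[of i] cpos[OF n] by (auto simp: t_def tsq[unfolded t_def] intro!: real_le_rsqrt)
          have total: "(\<Sum>i\<in>{1..n}. (t i)\<^sup>2) = 1"
            using Spos[OF n] by (simp add: tsq S_def flip: sum_divide_distrib)
          have "norm (complex_of_real (c n) ^ p * h n \<pi> \<phi>) \<le> K * (\<Prod>B\<in>\<pi>. t (\<phi> B) ^ card B)" if \<phi>: "\<phi> \<in> I n \<pi>" for \<phi>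
          proof -
            let ?w = "map (\<lambda>j. \<phi> (block \<pi> j)) [1..<Suc p]"
            have "set ?w \<subseteq> {1..n}" using \<phi> unfolding block_word_set[OF \<pi>] by (auto simp: I_def)
            then have "norm (h n \<pi> \<phi>) \<le> K * prod_list (map \<sigma> ?w)"
              unfolding h_def using assms(2,9) mom by (intro K(2)) auto
            also have "prod_list (map \<sigma> ?w) = (\<Prod>j\<in>{1..p}. \<sigma> (\<phi> (block \<pi> j)))"
              by (simp only: map_map o_def prod_list_map_upt)
            finally have "c n ^ p * norm (h n \<pi> \<phi>) \<le> c n ^ p * (K * (\<Prod>j\<in>{1..p}. \<sigma> (\<phi> (block \<pi> j))))"
              using cpos[OF n] by (intro mult_left_mono) auto
            also have "\<dots> = K * (\<Prod>j\<in>{1..p}. t (\<phi> (block \<pi> j)))"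
              by (simp add: t_def prod.distrib)
            also have "\<dots> = K * (\<Prod>B\<in>\<pi>. t (\<phi> B) ^ card B)"
              using prod_block[OF \<pi>, of "\<lambda>B. t (\<phi> B)"] by simp
            finally show ?thesis
              using cpos[OF n] by (simp add: norm_mult norm_power)
          qed
          then have "norm (T n \<pi>) \<le> (\<Sum>\<phi>\<in>I n \<pi>. K * (\<Prod>B\<in>\<pi>. t (\<phi> B) ^ card B))"
            unfolding T_def sum_distrib_left by (rule sum_norm_le)
          also have "\<dots> = K * (\<Sum>\<phi>\<in>I n \<pi>. \<Prod>B\<in>\<pi>. t (\<phi> B) ^ card B)"
            by (simp add: sum_distrib_left)
          also have "\<dots> \<le> K * (\<Prod>B\<in>\<pi>. sqrt (\<epsilon> n) ^ (card B - 2))"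
            unfolding I_def using K(1) t total 2(1) fin\<pi>
            by (intro mult_left_mono sum_injective_powers_le) auto
          finally show ?thesis .
        qed
        have "(\<lambda>n. K * (\<Prod>B\<in>\<pi>. sqrt (\<epsilon> n) ^ (card B - 2))) \<longlonglongrightarrow> K * (\<Prod>B\<in>\<pi>. sqrt 0 ^ (card B - 2))"
          by (intro tendsto_intros eps_lim)
        \<comment> \<open>The block \<open>D\<close> has a positive exponent and yields the factor
          0, whereas blocks of size 2 yield \<open>0 ^ 0 = 1\<close>.\<close>
        also have "(\<Prod>B\<in>\<pi>. sqrt 0 ^ (card B - 2)) = (0 :: real)"
          using 2(2,3) fin\<pi> by (intro prod_zero) (auto intro!: bexI[of _ D])
        finally have "(\<lambda>n. K * (\<Prod>B\<in>\<pi>. sqrt (\<epsilon> n) ^ (card B - 2))) \<longlonglongrightarrow> 0" by simp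
        then have "(\<lambda>n. T n \<pi>) \<longlonglongrightarrow> 0"
          by (rule Lim_null_comparison[rotated]) (use bound in \<open>rule eventually_sequentiallyI\<close>)
        moreover have "L \<pi> = 0" using 2(2,3) by (auto simp: L_def)
        ultimately show ?thesis by simp
      next
        case 3
        \<comment> \<open>\<open>R\<close> is the density \<open>W\<close> restricted to injective
          homomorphisms. It equals the contribution exactly and differs from \<open>W\<close> by at
          most a constant multiple of \<open>\<epsilon> n\<close>.\<close>
        define W where "W = (\<lambda>n. weighted_density \<pi> (intersection_edges \<pi>) {1..n} (G n) (\<lambda>k. (\<sigma> k)\<^sup>2))"
        define R where "R = (\<lambda>n. 1 / S n ^ card \<pi> *
          (\<Sum>\<phi> | \<phi> \<in> graph_homs \<pi> (intersection_edges \<pi>) {1..n} (G n) \<and> inj_on \<phi> \<pi>. \<Prod>B\<in>\<pi>. (\<sigma> (\<phi> B))\<^sup>2))"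
        \<comment> \<open>With \<open>(c n)\<^sup>2 = 1 / S n\<close>, this turns
          \<open>c n ^ p\<close> into the normalization of the density.\<close>
        have p: "p = 2 * card \<pi>"
          using partition_card_sum[OF \<pi>] 3 by simp
        have "T n \<pi> = complex_of_real (R n)" if n: "1 \<le> n" for n
        proof -
          have "(\<Sum>\<phi>\<in>I n \<pi>. h n \<pi> \<phi>) =
            (\<Sum>\<phi> | \<phi> \<in> graph_homs \<pi> (intersection_edges \<pi>) {1..n} (G n) \<and> inj_on \<phi> \<pi>. \<Prod>B\<in>\<pi>. complex_of_real ((\<sigma> (\<phi> B))\<^sup>2))"
            unfolding I_def h_def using aA assms(10,11) 3
            by (intro sum_state_pair_block_words[OF ind[OF n] _ _ \<pi>]) auto
          moreover have "complex_of_real (c n) ^ p = complex_of_real (1 / S n ^ card \<pi>)"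
            by (simp only: p power_mult csq[OF n] power_one_over flip: of_real_power)
          ultimately show ?thesis by (simp add: T_def R_def)
        qed
        then have TR: "eventually (\<lambda>n. complex_of_real (R n) = T n \<pi>) sequentially"
          by (intro eventually_sequentiallyI[of 1]) simp
        have "norm (R n - W n) \<le> (card \<pi>)\<^sup>2 * \<epsilon> n" if n: "1 \<le> n" for n
          using weighted_density_injective_approx[of "{1..n}" \<pi> "\<lambda>k. (\<sigma> k)\<^sup>2" "\<epsilon> n" "intersection_edges \<pi>" "G n"]
            eps Spos[OF n] fin\<pi> unfolding W_def R_def S_def by (simp add: abs_minus_commute)
        then have "eventually (\<lambda>n. norm (R n - W n) \<le> (card \<pi>)\<^sup>2 * \<epsilon> n) sequentially"
          by (rule eventually_sequentiallyI)
        moreover have "(\<lambda>n. (card \<pi>)\<^sup>2 * \<epsilon> n) \<longlonglongrightarrow> 0"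
          using tendsto_mult_left[OF eps_lim] by simp
        ultimately have "(\<lambda>n. R n - W n) \<longlonglongrightarrow> 0" by (rule Lim_null_comparison)
        moreover have "W \<longlonglongrightarrow> L \<pi>"
        proof -
          have "finite_simple_graph \<pi> (intersection_edges \<pi>)"
            unfolding finite_simple_graph_def intersection_edges_def card_2_iff using fin\<pi> by blast
          \<comment> \<open>Blocks are disjoint and nonempty, so their minima number them by
            distinct natural numbers, as the test graphs require.\<close>
          moreover have "inj_on Min \<pi>"
          proof (rule inj_onI)
            fix B B' assume B: "B \<in> \<pi>" "B' \<in> \<pi>" "Min B = Min B'"
            then have "Min B \<in> B" "Min B \<in> B'"
              using 3 Min_in by (metis card.empty card.infinite zero_neq_numeral)+
            with B show "B = B'" using block_eq[OF \<pi>] by metis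
          qed
          ultimately show ?thesis
            unfolding W_def using converges_to_graphon_finite_graph[OF assms(5)] 3 by (simp add: L_def)
        qed
        ultimately have "(\<lambda>n. R n) \<longlonglongrightarrow> L \<pi>"
          using Lim_transform by blast
        then have "(\<lambda>n. complex_of_real (R n)) \<longlonglongrightarrow> complex_of_real (L \<pi>)"
          by (rule tendsto_of_real)
        then show ?thesis using TR by (rule Lim_transform_eventually)
      qed
    qed
    then have "(\<lambda>n. \<Sum>\<pi> | partition_on {1..p} \<pi>. T n \<pi>) \<longlonglongrightarrow> (\<Sum>\<pi> | partition_on {1..p} \<pi>. complex_of_real (L \<pi>))"
      by (intro tendsto_sum) auto
    moreover have "(\<Sum>\<pi> | partition_on {1..p} \<pi>. complex_of_real (L \<pi>)) = complex_of_real (\<integral>x. x ^ p \<partial>\<mu>)"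
      using graphon_law_moment[OF assms(14), of p] False by (simp add: L_def)
    moreover have "\<tau> (smul (complex_of_real (c n)) (\<Sum>k\<in>{1..n}. a n k) ^ p) = (\<Sum>\<pi> | partition_on {1..p} \<pi>. T n \<pi>)" for n
      unfolding T_def I_def h_def by (rule state_power_sum_partitions) simp
    ultimately show ?thesis by simp
  qed
  with int show ?thesis
    by (simp add: converges_in_distribution_def c_def S_def)
qed

end
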